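(* Let $k\ge 2$ be an integer. The modular form $\mathcal{F}_k(z)=\mathcal{W}'_k(q)/\mathcal{W}_k(q)$ is identically zero if and only if $k=6t^2-6t+1$ for some integer $t\geq 2$.
   Context: Let $z$ be in the upper half-plane $\mathbb{H}$ and $q:=e^{2\pi i z}$; for rational $a$, $q^a:=e^{2\pi i a z}$. For an integer $k\ge 2$ put $c_k:=1-\frac{3(2k-1)^2}{2k+1}$, and for $1\le i\le k$ put $h_{i,k}:=\frac{(2(k-i)+1)^2-(2k-1)^2}{8(2k+1)}$ and $$\mathrm{ch}_{i,k}(q):=q^{h_{i,k}-\frac{c_k}{24}}\prod_{\substack{n\ge 1\\ n\not\equiv 0,\pm i\ (\mathrm{mod}\ 2k+1)}}\frac{1}{1-q^n}.$$ Differentiation is $\left(\sum a(n)q^n\right)':=\sum n\,a(n)q^n$ (exponents $n$ rational), i.e. $q\frac{d}{dq}=\frac{1}{2\pi i}\frac{d}{dz}$; $f^{(m)}$ denotes the $m$-th iterate. Define $$\mathcal{W}_k(q):=\alpha(k)\det\left(\mathrm{ch}_{i,k}^{(m)}\right)_{0\le m\le k-1,\ 1\le i\le k},\qquad \mathcal{W}'_k(q):=\beta(k)\det\left(\mathrm{ch}_{i,k}^{(m)}\right)_{1\le m\le k,\ 1\le i\le k},$$ where $m$ indexes rows and $i$ indexes columns. Here $\alpha(k)$ is the constant making the leading coefficient of the $q$-expansion of $\mathcal{W}_k$ equal to $1$; $\beta(k)$ is the nonzero constant making the leading coefficient of $\mathcal{W}'_k$ equal to $1$ if the second determinant is not identically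 zero, and $\mathcal{W}'_k=0$ if that determinant is identically zero. ($\mathcal{W}'_k$ is a name and is not the derivative of $\mathcal{W}_k$.) *)

theory Defs
  imports "HOL-Complex_Analysis.Complex_Analysis" "HOL-Number_Theory.Cong"
    "Jordan_Normal_Form.Determinant"
begin

definition upper_half_plane :: "complex set" where
  "upper_half_plane = {z. Im z > 0}"

text \<open>The rational power \<open>q\<^sup>a\<close> is fixed by the branch \<open>exp (2\<pi>iaz)\<close>, so it is a function of
  \<open>z\<close> rather than of \<open>q\<close>. All \<open>q\<close>-series below are accordingly functions of \<open>z\<close>; only their
  values on the upper half-plane matter.\<close>

definition qpow :: "rat \<Rightarrow> complex \<Rightarrow> complex" where
  "qpow a z = exp (2 * of_real pi * \<i> * of_rat a * z)"

definition central_charge :: "nat \<Rightarrow> rat" where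
  "central_charge k = 1 - 3 * (2 * of_nat k - 1)^2 / (2 * of_nat k + 1)"

definition conf_weight :: "nat \<Rightarrow> nat \<Rightarrow> rat" where
  "conf_weight i k =
     ((2 * (of_nat k - of_nat i) + 1)^2 - (2 * of_nat k - 1)^2) / (8 * (2 * of_nat k + 1))"

definition ch :: "nat \<Rightarrow> nat \<Rightarrow> complex \<Rightarrow> complex" where
  "ch i k z = qpow (conf_weight i k - central_charge k / 24) z *
     (\<Prod>n. if n \<ge> 1 \<and> \<not> [int n = 0] (mod (2 * int k + 1))
               \<and> \<not> [int n = int i] (mod (2 * int k + 1))
               \<and> \<not> [int n = - int i] (mod (2 * int k + 1))
            then 1 / (1 - qpow 1 z ^ n) else 1)"

text \<open>The operator \<open>q d/dq = (1/2\<pi>i) d/dz\<close>, which multiplies the coefficient of \<open>q\<^sup>n\<close> by \<open>n\<close>.\<close>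

definition qderiv :: "(complex \<Rightarrow> complex) \<Rightarrow> complex \<Rightarrow> complex" where
  "qderiv f = (\<lambda>z. deriv f z / (2 * of_real pi * \<i>))"

definition has_q_expansion :: "(complex \<Rightarrow> complex) \<Rightarrow> (rat \<Rightarrow> complex) \<Rightarrow> bool" where
  "has_q_expansion f a \<longleftrightarrow>
     (\<forall>z\<in>upper_half_plane. ((\<lambda>n. a n * qpow n z) has_sum f z) UNIV)"

definition has_leading_coeff :: "(complex \<Rightarrow> complex) \<Rightarrow> complex \<Rightarrow> bool" where
  "has_leading_coeff f c \<longleftrightarrow>
     (\<exists>a n. has_q_expansion f a \<and> a n = c \<and> c \<noteq> 0 \<and> (\<forall>m<n. a m = 0))"

text \<open>Matrix indices start at \<open>0\<close>: row \<open>m\<close> of the first determinant is the \<open>m\<close>-th derivative, row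
  \<open>m\<close> of the second one is the \<open>(m+1)\<close>-st, and column \<open>j\<close> belongs to the character with
  \<open>i = j + 1\<close>. The qualified names select the matrices of Jordan_Normal_Form, whose dimension is a
  natural number.\<close>

definition wronskian_det :: "nat \<Rightarrow> complex \<Rightarrow> complex" where
  "wronskian_det k z =
     Determinant.det (Matrix.mat k k (\<lambda>(m, j). (qderiv ^^ m) (ch (j + 1) k) z))"

definition wronskian_det' :: "nat \<Rightarrow> complex \<Rightarrow> complex" where
  "wronskian_det' k z =
     Determinant.det (Matrix.mat k k (\<lambda>(m, j). (qderiv ^^ (m + 1)) (ch (j + 1) k) z))"

definition alpha :: "nat \<Rightarrow> complex" where
  "alpha k = (THE c. has_leading_coeff (\<lambda>z. c * wronskian_det k z) 1)"

definition beta :: "nat \<Rightarrow> complex" where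
  "beta k = (THE c. has_leading_coeff (\<lambda>z. c * wronskian_det' k z) 1)"

definition W :: "nat \<Rightarrow> complex \<Rightarrow> complex" where
  "W k z = alpha k * wronskian_det k z"

definition W' :: "nat \<Rightarrow> complex \<Rightarrow> complex" where
  "W' k z = (if \<forall>w\<in>upper_half_plane. wronskian_det' k w = 0 then 0
             else beta k * wronskian_det' k z)"

definition F :: "nat \<Rightarrow> complex \<Rightarrow> complex" where
  "F k z = W' k z / W k z"

end

theory Submission imports Defs begin

text \<open>The exponent of the leading term of \<open>ch i k\<close> is \<open>(2k+1-2i)\<^sup>2/(8(2k+1)) - 1/24\<close>. These
  exponents are distinct for \<open>1 \<le> i \<le> k\<close>, and one of them vanishes iff \<open>2k+1\<close> is three times an odd
  square, which is the condition \<open>k = 6t\<^sup>2 - 6t + 1\<close>. If none vanishes, the leading coefficients of both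
  determinants are nonzero by Vandermonde, so the quotient is not identically zero. If
  \<open>2k+1 = 3s\<^sup>2\<close>, then by the Jacobi triple product the dissection of Euler's pentagonal number series
  modulo \<open>s\<close> says that a signed sum of the characters equals the constant \<open>1\<close>; differentiating this
  relation makes the columns of the second determinant linearly dependent.\<close>

subsection \<open>The Jacobi triple product\<close>

text \<open>Two features of the definitions shape the nonvanishing half. The normalizing constants
  are given by \<open>THE\<close>, so they can be used only after leading coefficients are shown to
  be unique among expansions indexed by all rationals. And division by 0 gives 0, so a nonzero value
  of \<open>F\<close> requires a point where both determinants are nonzero. Both points are settled
  by writing each function as \<open>q^e g(q)\<close> with \<open>g\<close> holomorphic on the unit
  disc and moving up the imaginary axis. At \<open>q = 0\<close> the operator \<open>q d/dq\<close>
  multiplies \<open>g\<close> by \<open>e\<close>, which is the origin of the Vandermonde matrix. In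
  the other half, \<open>s\<close> is the odd number \<open>2k+1-2i\<close> whose square makes an
  exponent vanish. Euler's series has exponents \<open>n(3n-1)/2\<close>; putting
  \<open>n = s m + r\<close> gives theta series in \<open>m\<close> of modulus \<open>3s^2\<close>,
  exactly the modulus \<open>2k+1\<close> of the characters. The constant 1 is Euler's product
  divided by itself.\<close>

text \<open>Dominated convergence for sums: by the Weierstrass M-test the finite partial sums
  converge uniformly in the parameter, so the two limits may be exchanged. It serves both the triple
  product and the limits of q-expansions.\<close>

lemma has_sum_tannery:
  fixes f :: "'a \<Rightarrow> 'b \<Rightarrow> 'c :: banach"
  assumes bound: "eventually (\<lambda>y. \<forall>x\<in>A. norm (f x y) \<le> M x) G"
    and M: "M summable_on A"
    and sum: "eventually (\<lambda>y. ((\<lambda>x. f x y) has_sum S y) A) G"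
    and lim: "\<And>x. x \<in> A \<Longrightarrow> (f x \<longlongrightarrow> g x) G"
    and nontriv: "G \<noteq> bot"
  shows "(S \<longlongrightarrow> infsum g A) G"
proof -
  have le: "norm (g x) \<le> M x" if "x \<in> A" for x
    by (rule tendsto_upperbound[OF tendsto_norm[OF lim[OF that]] _ nontriv])
       (use bound that in \<open>auto elim: eventually_mono\<close>)
  have "(\<lambda>x. norm (g x)) summable_on A"
    by (rule Infinite_Sum.abs_summable_on_comparison_test'[OF M le])
  then have g: "(g has_sum infsum g A) A"
    by (rule has_sum_infsum[OF abs_summable_summable])
  define Y where "Y = {y. (\<forall>x\<in>A. norm (f x y) \<le> M x) \<and> ((\<lambda>x. f x y) has_sum S y) A}"
  show "(S \<longlongrightarrow> infsum g A) G"
  proof (rule swap_uniform_limit')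
    show "uniform_limit Y (\<lambda>X y. \<Sum>x\<in>X. f x y) S (finite_subsets_at_top A)"
      by (rule Weierstrass_m_test_general'[OF _ _ M]) (auto simp: Y_def)
    show "((\<lambda>X. \<Sum>x\<in>X. g x) \<longlongrightarrow> infsum g A) (finite_subsets_at_top A)"
      using g by (simp add: has_sum_def)
    show "\<forall>\<^sub>F X in finite_subsets_at_top A. ((\<lambda>y. \<Sum>x\<in>X. f x y) \<longlongrightarrow> (\<Sum>x\<in>X. g x)) G"
      by (rule eventually_finite_subsets_at_top_weakI) (intro tendsto_sum, use lim in blast)
    show "\<forall>\<^sub>F y in G. y \<in> Y"
      using bound sum by eventually_elim (auto simp: Y_def)
  qed auto
qed

section \<open>Infinite products over a set of exponents\<close>

definition euler_prod :: "nat set \<Rightarrow> complex \<Rightarrow> complex" where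
  "euler_prod S w = (\<Prod>n. if n \<in> S then 1 - w ^ n else 1)"

lemma euler_factor_nonzero:
  fixes w :: complex
  assumes "norm w < 1" "0 \<notin> S"
  shows "(if n \<in> S then 1 - w ^ n else 1) \<noteq> 0"
proof -
  have "w ^ n \<noteq> 1" if "n \<in> S"
  proof
    assume "w ^ n = 1"
    then have "norm w = 1" if "n \<noteq> 0"
      using that power_eq_1_iff[of w n] by auto
    then show False using assms that by (cases "n = 0") auto
  qed
  then show ?thesis by auto
qed

lemma convergent_prod_euler:
  fixes w :: complex
  assumes "norm w < 1"
  shows "convergent_prod (\<lambda>n. if n \<in> S then 1 - w ^ n else 1)"
proof (intro abs_convergent_prod_imp_convergent_prod summable_imp_abs_convergent_prod)
  show "summable (\<lambda>n. norm ((if n \<in> S then 1 - w ^ n else 1) - 1))"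
    by (rule summable_comparison_test'[where g = "\<lambda>n. norm w ^ n" and N = 0])
       (use assms in \<open>auto simp: norm_power\<close>)
qed

lemma euler_prod_nonzero:
  assumes "norm w < 1" "0 \<notin> S"
  shows "euler_prod S w \<noteq> 0"
  unfolding euler_prod_def
  by (intro prodinf_nonzero convergent_prod_euler euler_factor_nonzero assms)

lemma euler_prod_lim:
  assumes "norm w < 1"
  shows "(\<lambda>N. \<Prod>n\<le>N. if n \<in> S then 1 - w ^ n else 1) \<longlonglongrightarrow> euler_prod S w"
  unfolding euler_prod_def by (intro convergent_prod_LIMSEQ convergent_prod_euler assms)

lemma euler_prod_inverse:
  assumes "norm w < 1"
  shows "(\<Prod>n. if n \<in> S then 1 / (1 - w ^ n) else 1) = 1 / euler_prod S w"
proof -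
  have "(\<lambda>n. if n \<in> S then 1 / (1 - w ^ n) else 1) = (\<lambda>n. inverse (if n \<in> S then 1 - w ^ n else 1))"
    by (auto simp: fun_eq_iff field_simps)
  then show ?thesis
    using prodinf_inverse[OF convergent_prod_euler[OF assms, of S]]
    by (simp add: euler_prod_def inverse_eq_divide)
qed

lemma euler_prod_Un:
  assumes "norm w < 1" "S \<inter> T = {}"
  shows "euler_prod (S \<union> T) w = euler_prod S w * euler_prod T w"
  unfolding euler_prod_def
  by (subst prodinf_mult[OF convergent_prod_euler convergent_prod_euler, OF assms(1) assms(1)])
     (use assms(2) in \<open>auto intro!: arg_cong[of _ _ prodinf] simp: fun_eq_iff\<close>)

lemma euler_prod_0:
  assumes "0 \<notin> S"
  shows "euler_prod S 0 = 1"
proof -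
  have "(\<lambda>n. if n \<in> S then 1 - 0 ^ n else 1) = (\<lambda>_. 1 :: complex)"
    using assms by (auto simp: fun_eq_iff power_0_left)
  then show ?thesis by (simp add: euler_prod_def)
qed

text \<open>The finite products are polynomials, and on a closed disc of radius \<open>r < 1\<close>
  the deviations of the factors from 1 are dominated by \<open>r^n\<close>; locally uniform limits
  of holomorphic functions are holomorphic.\<close>

lemma holomorphic_euler_prod: "euler_prod S holomorphic_on ball 0 1"
proof (rule holomorphic_uniform_sequence)
  show "(\<lambda>w. \<Prod>n<N. if n \<in> S then 1 - w ^ n else 1) holomorphic_on ball 0 1" for N
  proof (intro holomorphic_on_prod)
    show "(\<lambda>w. if n \<in> S then 1 - w ^ n else 1) holomorphic_on ball 0 1" for n
      by (cases "n \<in> S") (auto intro!: holomorphic_intros)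
  qed
  fix x :: complex assume x: "x \<in> ball 0 1"
  \<comment> \<open>Half the distance to the unit circle, so that the closed disc around
    \<open>x\<close> stays within radius \<open>r = (1 + norm x) / 2 < 1\<close>.\<close>
  define d where "d = (1 - norm x) / 2"
  define r where "r = norm x + d"
  have d: "d > 0" "r < 1" "0 \<le> r" using x by (auto simp: d_def r_def field_simps add_nonneg_nonneg)
  have r: "norm w \<le> r" if "w \<in> cball x d" for w
    using that norm_triangle_sub[of w x] by (auto simp: r_def dist_norm norm_minus_commute)
  let ?P = "\<lambda>N w. \<Prod>n<N. if n \<in> S then 1 - w ^ n else (1::complex)"
  have "uniformly_convergent_on (cball x d) ?P"
  proof (rule uniformly_convergent_on_prod')
    show "uniformly_convergent_on (cball x d)
       (\<lambda>N w. \<Sum>n<N. norm ((if n \<in> S then 1 - w ^ n else 1) - 1))"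
    proof (rule Weierstrass_m_test')
      show "norm (norm ((if n \<in> S then 1 - w ^ n else 1) - 1)) \<le> r ^ n" if "w \<in> cball x d" for n w
        using r[OF that] d by (auto simp: norm_power intro!: power_mono)
      show "summable (\<lambda>n. r ^ n)" using d by (intro summable_geometric) auto
    qed
    show "continuous_on (cball x d) (\<lambda>w. if n \<in> S then 1 - w ^ n else 1)" for n
      by (cases "n \<in> S") (auto intro!: continuous_intros)
  qed auto
  then obtain l where l: "uniform_limit (cball x d) ?P l sequentially"
    by (auto simp: uniformly_convergent_on_def)
  have "l w = euler_prod S w" if "w \<in> cball x d" for w
  proof (rule LIMSEQ_unique)
    show "(\<lambda>N. ?P N w) \<longlonglongrightarrow> l w" by (rule tendsto_uniform_limitI[OF l that])
    show "(\<lambda>N. ?P N w) \<longlonglongrightarrow> euler_prod S w"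
      using euler_prod_lim[of w S] r[OF that] d
        LIMSEQ_lessThan_iff_atMost[of "\<lambda>I. \<Prod>n\<in>I. if n \<in> S then 1 - w ^ n else 1"] by simp
  qed
  then have "uniform_limit (cball x d) ?P (euler_prod S) sequentially"
    using l uniform_limit_cong'[of "cball x d" ?P ?P l "euler_prod S" sequentially] by simp
  moreover have "cball x d \<subseteq> ball 0 1"
    using r d by (fastforce simp: subset_iff)
  ultimately show "\<exists>d>0. cball x d \<subseteq> ball 0 1 \<and> uniform_limit (cball x d) ?P (euler_prod S) sequentially"
    using d by blast
qed auto

section \<open>Gaussian binomials and the finite triple product\<close>

definition qpoch :: "complex \<Rightarrow> nat \<Rightarrow> complex" where
  "qpoch q n = (\<Prod>j<n. 1 - q ^ Suc j)"

lemma qpoch_0 [simp]: "qpoch q 0 = 1"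
  and qpoch_Suc: "qpoch q (Suc n) = qpoch q n * (1 - q ^ Suc n)"
  by (simp_all add: qpoch_def)

lemma qpoch_eq: "qpoch q N = (\<Prod>n\<le>N. if n \<in> {1..} then 1 - q ^ n else 1)"
  by (induction N) (auto simp: qpoch_Suc)

lemma qpoch_nonzero:
  assumes "norm q < 1"
  shows "qpoch q n \<noteq> 0"
  unfolding qpoch_eq using euler_factor_nonzero[OF assms, of "{1..}"] by (auto simp: prod_zero_iff)

lemma qpoch_lim:
  assumes "norm q < 1"
  shows "qpoch q \<longlonglongrightarrow> euler_prod {1..} q"
  unfolding qpoch_eq[abs_def] by (rule euler_prod_lim[OF assms])

text \<open>Gaussian binomial coefficients through a q-Pascal rule rather than as quotients of
  \<open>qpoch\<close>, so that the q-binomial theorem holds for every \<open>q\<close>. When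
  \<open>k > n\<close> the truncated exponent \<open>n - k\<close> is harmless, since its cofactor
  vanishes.\<close>

fun qbinom :: "complex \<Rightarrow> nat \<Rightarrow> nat \<Rightarrow> complex" where
  "qbinom q n 0 = 1"
| "qbinom q 0 (Suc k) = 0"
| "qbinom q (Suc n) (Suc k) = qbinom q n (Suc k) + q ^ (n - k) * qbinom q n k"

lemma qbinom_eq_0: "k > n \<Longrightarrow> qbinom q n k = 0"
  by (induction q n k rule: qbinom.induct) auto

text \<open>The two summands of the Pascal rule combine through
  \<open>(1 - q^(n-k)) + q^(n-k) (1 - q^(k+1)) = 1 - q^(n+1)\<close>.\<close>

lemma qbinom_qpoch: "k \<le> n \<Longrightarrow> qbinom q n k * qpoch q k * qpoch q (n - k) = qpoch q n"
proof (induction q n k rule: qbinom.induct)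
  case (3 q n k)
  have 1: "qbinom q n (Suc k) * qpoch q (Suc k) * qpoch q (n - k) = qpoch q n * (1 - q ^ (n - k))"
  proof (cases "k = n")
    case False
    then have "n - k = Suc (n - Suc k)" using 3 by simp
    then show ?thesis using 3 False by (simp add: qpoch_Suc flip: mult.assoc)
  qed (simp add: qbinom_eq_0)
  have 2: "qbinom q n k * qpoch q (Suc k) * qpoch q (n - k) = qpoch q n * (1 - q ^ Suc k)"
  proof -
    have "qbinom q n k * qpoch q (Suc k) * qpoch q (n - k) =
        (qbinom q n k * qpoch q k * qpoch q (n - k)) * (1 - q ^ Suc k)"
      by (simp only: qpoch_Suc ac_simps)
    then show ?thesis using 3 by simp
  qed
  have "qbinom q (Suc n) (Suc k) * qpoch q (Suc k) * qpoch q (n - k) =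
      qbinom q n (Suc k) * qpoch q (Suc k) * qpoch q (n - k)
      + q ^ (n - k) * (qbinom q n k * qpoch q (Suc k) * qpoch q (n - k))"
    by (simp add: algebra_simps)
  also have "\<dots> = qpoch q n * (1 - q ^ (n - k)) + q ^ (n - k) * (qpoch q n * (1 - q ^ Suc k))"
    unfolding 1 2 ..
  also have "\<dots> = qpoch q n * (1 - q ^ (n - k) * q ^ Suc k)" by (simp add: algebra_simps)
  also have "q ^ (n - k) * q ^ Suc k = q ^ Suc n"
    using 3 by (simp flip: power_add)
  finally show ?case by (simp add: qpoch_Suc)
qed auto

text \<open>Multiplying by the last factor \<open>1 + y q^n\<close> matches the Pascal rule, because
  \<open>(k+1 choose 2) = (k choose 2) + k\<close> and \<open>q^(n-k) q^k = q^n\<close>.\<close>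

lemma qbinomial_theorem:
  "(\<Prod>j<n. 1 + y * q ^ j) = (\<Sum>k\<le>n. qbinom q n k * q ^ (k choose 2) * y ^ k)"
proof (induction n)
  case (Suc n)
  let ?t = "\<lambda>k. qbinom q n k * q ^ (k choose 2) * y ^ k"
  have "(\<Sum>k\<le>Suc n. qbinom q (Suc n) k * q ^ (k choose 2) * y ^ k) =
      1 + (\<Sum>k\<le>n. qbinom q (Suc n) (Suc k) * q ^ (Suc k choose 2) * y ^ Suc k)"
    by (subst sum.atMost_Suc_shift) (simp add: numeral_2_eq_2)
  also have "(\<Sum>k\<le>n. qbinom q (Suc n) (Suc k) * q ^ (Suc k choose 2) * y ^ Suc k) =
      (\<Sum>k\<le>n. ?t (Suc k) + y * q ^ n * ?t k)"
  proof (intro sum.cong refl)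
    fix k assume "k \<in> {..n}"
    then have "q ^ (n - k) * q ^ k = q ^ n" by (simp flip: power_add)
    then show "qbinom q (Suc n) (Suc k) * q ^ (Suc k choose 2) * y ^ Suc k = ?t (Suc k) + y * q ^ n * ?t k"
      by (simp add: numeral_2_eq_2 power_add algebra_simps)
  qed
  also have "1 + \<dots> = (1 + (\<Sum>k\<le>n. ?t (Suc k))) + y * q ^ n * (\<Sum>k\<le>n. ?t k)"
    by (simp add: sum.distrib sum_distrib_left)
  also have "1 + (\<Sum>k\<le>n. ?t (Suc k)) = (\<Sum>k\<le>Suc n. ?t k)"
    by (subst sum.atMost_Suc_shift) (simp add: numeral_2_eq_2)
  also have "\<dots> = (\<Sum>k\<le>n. ?t k)"
    by (simp add: qbinom_eq_0)
  finally show ?case using Suc by (simp add: algebra_simps)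
qed (simp add: numeral_2_eq_2)

text \<open>The general term of the bilateral theta series of the triple product; the
  \<open>div\<close> is exact because \<open>n (n - 1)\<close> is even.\<close>

definition theta_term :: "complex \<Rightarrow> complex \<Rightarrow> int \<Rightarrow> complex" where
  "theta_term q x n = (- x) powi n * q powi (n * (n - 1) div 2)"

lemma theta_term_0 [simp]: "theta_term q x 0 = 1"
  by (simp add: theta_term_def)

lemma theta_term_add_1:
  assumes "q \<noteq> 0" "x \<noteq> 0"
  shows "theta_term q x (n + 1) = theta_term q x n * (- x * q powi n)"
proof -
  have "(n + 1) * (n + 1 - 1) div 2 = n * (n - 1) div 2 + n"
  proof -
    have "(n + 1) * (n + 1 - 1) = n * (n - 1) + n * 2" by (simp add: algebra_simps)
    then show ?thesis by simp
  qed
  then show ?thesis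
    using assms by (simp add: theta_term_def power_int_add)
qed

text \<open>This is the q-binomial theorem with \<open>2 N\<close> factors, recentred: the upper
  half of the factors gives \<open>1 - x q^j\<close>, the lower half gives
  \<open>1 - q^(j+1) / x\<close> up to a monomial, and the summation index moves by
  \<open>N\<close>.\<close>

lemma finite_jacobi_triple_product:
  assumes q: "q \<noteq> 0" and x: "x \<noteq> 0"
  shows "(\<Prod>j<N. (1 - x * q ^ j) * (1 - q ^ Suc j / x)) =
    (\<Sum>n\<in>{-int N..int N}. qbinom q (2 * N) (nat (int N + n)) * theta_term q x n)"
proof -
  define T where "T = theta_term q x"
  define y where "y = - x * q powi (- int N)"
  have T1: "T (n + 1) = T n * (- x * q powi n)" for n
    unfolding T_def by (rule theta_term_add_1[OF q x])
  \<comment> \<open>\<open>T (- int N)\<close> is the product of the monomials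
    \<open>- q^(j+1) / x\<close>, and each of them turns \<open>1 - x q^(-(j+1))\<close> into
    \<open>1 - q^(j+1) / x\<close>.\<close>
  have low: "T (- int N) * (\<Prod>j<N. 1 - x * q powi (- int (Suc j))) = (\<Prod>j<N. 1 - q ^ Suc j / x)" for N
  proof (induction N)
    case (Suc N)
    define Q where "Q = q ^ Suc N"
    have Q: "Q \<noteq> 0" using q by (simp add: Q_def)
    have inv: "q powi (- int (Suc N)) = 1 / Q"
      by (simp only: power_int_minus power_int_of_nat inverse_eq_divide Q_def)
    have "T (- int N) = T (- int (Suc N)) * (- x * (1 / Q))"
      using T1[of "- int (Suc N)"] unfolding inv by simp
    then have T': "T (- int (Suc N)) = - (Q / x) * T (- int N)"
      using Q x by (simp add: field_simps)
    have step: "T (- int (Suc N)) * (1 - x * q powi (- int (Suc N))) = T (- int N) * (1 - Q / x)"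
      using Q x unfolding inv T' by (simp add: field_simps)
    have "T (- int (Suc N)) * (\<Prod>j<Suc N. 1 - x * q powi (- int (Suc j))) =
        (T (- int (Suc N)) * (1 - x * q powi (- int (Suc N)))) * (\<Prod>j<N. 1 - x * q powi (- int (Suc j)))"
      by (simp only: prod.lessThan_Suc ac_simps)
    also have "\<dots> = (T (- int N) * (\<Prod>j<N. 1 - x * q powi (- int (Suc j)))) * (1 - Q / x)"
      unfolding step by (simp only: ac_simps)
    also have "\<dots> = (\<Prod>j<Suc N. 1 - q ^ Suc j / x)"
      unfolding Suc Q_def by (simp only: prod.lessThan_Suc)
    finally show ?case .
  qed (simp add: T_def)
  have shift: "T (- int N) * (q ^ (k choose 2) * y ^ k) = T (int k - int N)" for k
  proof (induction k)
    case (Suc k)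
    have "T (int (Suc k) - int N) = T (int k - int N) * (- x * q powi (int k - int N))"
      using T1[of "int k - int N"] by (simp add: algebra_simps)
    also have "- x * q powi (int k - int N) = y * q ^ k"
      using q by (simp add: y_def power_int_diff power_int_minus field_simps)
    also have "T (int k - int N) = T (- int N) * (q ^ (k choose 2) * y ^ k)"
      by (rule Suc[symmetric])
    also have "T (- int N) * (q ^ (k choose 2) * y ^ k) * (y * q ^ k) = T (- int N) * (q ^ (Suc k choose 2) * y ^ Suc k)"
      by (simp add: numeral_2_eq_2 power_add algebra_simps)
    finally show ?case ..
  qed (simp add: numeral_2_eq_2)
  have "(\<Prod>j<2*N. 1 + y * q ^ j) = (\<Prod>j<N. 1 + y * q ^ j) * (\<Prod>j<N. 1 + y * q ^ (j + N))"
    using prod.atLeastLessThan_concat[of 0 N "2*N" "\<lambda>j. 1 + y * q ^ j"]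
      prod.shift_bounds_nat_ivl[of "\<lambda>j. 1 + y * q ^ j" 0 N N]
    by (simp add: atLeast0LessThan mult_2)
  also have "(\<Prod>j<N. 1 + y * q ^ (j + N)) = (\<Prod>j<N. 1 - x * q ^ j)"
    using q by (intro prod.cong) (simp_all add: y_def power_add power_int_minus)
  also have "(\<Prod>j<N. 1 + y * q ^ j) = (\<Prod>j<N. 1 + y * q ^ (N - Suc j))"
    by (rule prod.nat_diff_reindex[symmetric])
  also have "\<dots> = (\<Prod>j<N. 1 - x * q powi (- int (Suc j)))"
  proof (intro prod.cong refl)
    fix j assume "j \<in> {..<N}"
    then have "q ^ (N - Suc j) = q powi (int N - int (Suc j))"
      by (metis Suc_leI lessThan_iff of_nat_diff power_int_of_nat)
    also have "\<dots> = q powi int N * q powi (- int (Suc j))"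
      unfolding diff_conv_add_uminus by (rule power_int_add) (use q in simp)
    finally show "1 + y * q ^ (N - Suc j) = 1 - x * q powi (- int (Suc j))"
      using q by (simp add: y_def power_int_minus)
  qed
  finally have "T (- int N) * (\<Prod>j<2*N. 1 + y * q ^ j) =
      (\<Prod>j<N. 1 - q ^ Suc j / x) * (\<Prod>j<N. 1 - x * q ^ j)"
    by (simp only: low[symmetric] mult.assoc)
  then have "(\<Prod>j<N. (1 - x * q ^ j) * (1 - q ^ Suc j / x)) = T (- int N) * (\<Prod>j<2*N. 1 + y * q ^ j)"
    by (simp add: prod.distrib)
  also have "\<dots> = (\<Sum>k\<le>2*N. qbinom q (2*N) k * (T (- int N) * (q ^ (k choose 2) * y ^ k)))"
    unfolding qbinomial_theorem sum_distrib_left by (simp add: algebra_simps)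
  also have "\<dots> = (\<Sum>k\<le>2*N. qbinom q (2*N) k * T (int k - int N))"
    unfolding shift ..
  also have "\<dots> = (\<Sum>n\<in>{-int N..int N}. qbinom q (2 * N) (nat (int N + n)) * T n)"
    by (rule sum.reindex_bij_witness[of _ "\<lambda>n. nat (int N + n)" "\<lambda>k. int k - int N"]) auto
  finally show ?thesis unfolding T_def .
qed


text \<open>In both directions the ratio of consecutive terms has the form \<open>c q^n\<close> and
  tends to 0, so the ratio test applies to each half of the integers.\<close>

lemma theta_term_summable:
  assumes q: "norm q < 1" "q \<noteq> 0" and x: "x \<noteq> 0"
  shows "(\<lambda>n. norm (theta_term q x n)) summable_on UNIV"
proof -
  have pow: "(\<lambda>n. q ^ n) \<longlonglongrightarrow> 0"
    using q by (intro LIMSEQ_power_zero) auto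
  have ratio: "summable (\<lambda>n. norm (f n))"
    if step: "\<And>n. f (Suc n) = f n * (c * q ^ n)" for f :: "nat \<Rightarrow> complex" and c
  proof -
    have "(\<lambda>n. norm (c * q ^ n)) \<longlonglongrightarrow> 0"
      using tendsto_norm_zero[OF tendsto_mult_right_zero[OF pow]] .
    then have "eventually (\<lambda>n. norm (c * q ^ n) < 1/2) sequentially"
      by (rule order_tendstoD) simp
    then obtain N where N: "\<And>n. n \<ge> N \<Longrightarrow> norm (c * q ^ n) < 1/2"
      by (auto simp: eventually_sequentially)
    have "norm (f (Suc n)) \<le> 1/2 * norm (f n)" if "n \<ge> N" for n
    proof -
      have "norm (f (Suc n)) = norm (c * q ^ n) * norm (f n)"
        unfolding step norm_mult by simp
      also have "\<dots> \<le> 1/2 * norm (f n)"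
        using N[OF that] by (intro mult_right_mono) auto
      finally show ?thesis .
    qed
    then show ?thesis
      by (intro summable_ratio_test[where c = "1/2" and N = N]) auto
  qed
  have pos: "summable (\<lambda>n. norm (theta_term q x (int n)))"
  proof (rule ratio)
    show "theta_term q x (int (Suc n)) = theta_term q x (int n) * (- x * q ^ n)" for n
      using theta_term_add_1[OF q(2) x, of "int n"] by (simp add: add.commute)
  qed
  have neg: "summable (\<lambda>n. norm (theta_term q x (- int n)))"
  proof (rule ratio)
    fix n
    have inv: "q powi (- int (Suc n)) = 1 / q ^ Suc n"
      by (simp only: power_int_minus power_int_of_nat inverse_eq_divide)
    have "theta_term q x (- int n) = theta_term q x (- int (Suc n)) * (- x * (1 / q ^ Suc n))"
      using theta_term_add_1[OF q(2) x, of "- int (Suc n)"] unfolding inv by simp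
    then show "theta_term q x (- int (Suc n)) = theta_term q x (- int n) * ((- q / x) * q ^ n)"
      using q x by (simp add: field_simps)
  qed
  have "(\<lambda>n. norm (theta_term q x n)) summable_on range int"
    using pos by (subst summable_on_reindex) (auto simp: o_def summable_on_UNIV_nonneg_real_iff)
  moreover have "(\<lambda>n. norm (theta_term q x n)) summable_on range (\<lambda>n. - int n)"
    using neg by (subst summable_on_reindex) (auto simp: o_def inj_on_def summable_on_UNIV_nonneg_real_iff)
  ultimately have "(\<lambda>n. norm (theta_term q x n)) summable_on (range int \<union> range (\<lambda>n. - int n))"
    by (rule summable_on_union)
  moreover have "range int \<union> range (\<lambda>n. - int n) = UNIV"
    by (metis (no_types, lifting) UNIV_eq_I UnI1 UnI2 int_cases2 rangeI)
  ultimately show ?thesis by simp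
qed

text \<open>Multiplied by \<open>qpoch q N\<close>, the coefficient of each theta term in the finite
  identity tends to \<open>P P / (P P) = 1\<close>. These coefficients are bounded uniformly because
  \<open>qpoch q\<close> and its inverse converge, so the limit may be taken termwise.\<close>

theorem jacobi_triple_product:
  assumes q: "norm q < 1" "q \<noteq> 0" and x: "x \<noteq> 0"
  shows "(\<lambda>N. \<Prod>j<N. (1 - q ^ Suc j) * (1 - x * q ^ j) * (1 - q ^ Suc j / x))
           \<longlonglongrightarrow> infsum (theta_term q x) UNIV"
proof -
  define P where "P = euler_prod {1..} q"
  have P: "P \<noteq> 0" unfolding P_def by (rule euler_prod_nonzero[OF q(1)]) auto
  have lim: "qpoch q \<longlonglongrightarrow> P" unfolding P_def by (rule qpoch_lim[OF q(1)])
  have "Bseq (qpoch q)" using lim by (intro convergent_imp_Bseq convergentI)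
  then obtain B where B: "B > 0" "\<And>n. norm (qpoch q n) \<le> B" by (auto simp: Bseq_def)
  have "Bseq (\<lambda>n. inverse (qpoch q n))"
    using tendsto_inverse[OF lim P] by (intro convergent_imp_Bseq convergentI)
  then obtain C where C: "C > 0" "\<And>n. norm (inverse (qpoch q n)) \<le> C" by (auto simp: Bseq_def)
  \<comment> \<open>Extension by 0 outside the window turns the finite sums into sums over all
    integers, as dominated convergence requires.\<close>
  define a where "a N n = (if n \<in> {-int N..int N}
      then qpoch q N * (qbinom q (2 * N) (nat (int N + n)) * theta_term q x n) else 0)" for N n
  have a_eq: "a N n = qpoch q N * qpoch q (2 * N) * inverse (qpoch q (nat (int N + n)))
      * inverse (qpoch q (nat (int N - n))) * theta_term q x n"
    if "n \<in> {-int N..int N}" for N n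
  proof -
    define m l where "m = nat (int N + n)" and "l = nat (int N - n)"
    have "m \<le> 2 * N" "2 * N - m = l" using that by (auto simp: m_def l_def)
    then have "qbinom q (2 * N) m * qpoch q m * qpoch q l = qpoch q (2 * N)"
      using qbinom_qpoch[of m "2 * N" q] by simp
    then have "qbinom q (2 * N) m = qpoch q (2 * N) * inverse (qpoch q m) * inverse (qpoch q l)"
      using qpoch_nonzero[OF q(1)] by (simp add: field_simps)
    then show ?thesis using that by (simp add: a_def m_def l_def)
  qed
  have "((\<lambda>N. \<Prod>j<N. (1 - q ^ Suc j) * (1 - x * q ^ j) * (1 - q ^ Suc j / x)) \<longlongrightarrow>
      infsum (theta_term q x) UNIV) sequentially"
  proof (rule has_sum_tannery)
    show "eventually (\<lambda>N. \<forall>n\<in>UNIV. norm (a N n) \<le> B * B * C * C * norm (theta_term q x n)) sequentially"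
    proof (intro always_eventually allI ballI)
      fix N n
      show "norm (a N n) \<le> B * B * C * C * norm (theta_term q x n)"
      proof (cases "n \<in> {-int N..int N}")
        case True
        show ?thesis unfolding a_eq[OF True] norm_mult
          by (intro mult_mono B C mult_nonneg_nonneg norm_ge_zero order.refl less_imp_le[OF B(1)]
              less_imp_le[OF C(1)])
      next
        case False
        then have "a N n = 0" by (auto simp: a_def)
        then show ?thesis using B(1) C(1) by simp
      qed
    qed
    show "(\<lambda>n. B * B * C * C * norm (theta_term q x n)) summable_on UNIV"
      by (intro summable_on_cmult_right theta_term_summable q x)
    show "eventually (\<lambda>N. ((\<lambda>n. a N n) has_sum
        (\<Prod>j<N. (1 - q ^ Suc j) * (1 - x * q ^ j) * (1 - q ^ Suc j / x))) UNIV) sequentially"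
    proof (intro always_eventually allI)
      fix N
      have "(\<Prod>j<N. (1 - q ^ Suc j) * (1 - x * q ^ j) * (1 - q ^ Suc j / x)) =
          qpoch q N * (\<Prod>j<N. (1 - x * q ^ j) * (1 - q ^ Suc j / x))"
        by (simp only: qpoch_def prod.distrib mult.assoc)
      also have "\<dots> = (\<Sum>n\<in>{-int N..int N}. a N n)"
        unfolding finite_jacobi_triple_product[OF q(2) x] sum_distrib_left
        by (intro sum.cong) (simp_all add: a_def)
      finally have eq: "(\<Prod>j<N. (1 - q ^ Suc j) * (1 - x * q ^ j) * (1 - q ^ Suc j / x)) = \<dots>" .
      show "((\<lambda>n. a N n) has_sum
        (\<Prod>j<N. (1 - q ^ Suc j) * (1 - x * q ^ j) * (1 - q ^ Suc j / x))) UNIV"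
        unfolding eq by (rule has_sum_finite_neutralI[of "{-int N..int N}"]) (auto simp: a_def)
    qed
    show "(\<lambda>N. a N n) \<longlonglongrightarrow> theta_term q x n" for n
    proof -
      have N2: "filterlim (\<lambda>N. 2 * N) at_top (sequentially :: nat filter)"
        by (intro filterlim_subseq) (auto simp: strict_mono_def)
      have shift: "filterlim (\<lambda>N. nat (int N + m)) at_top sequentially" for m
        unfolding filterlim_at_top
      proof
        fix Z
        show "eventually (\<lambda>N. Z \<le> nat (int N + m)) sequentially"
          using eventually_ge_at_top[of "Z + nat \<bar>m\<bar>"] by eventually_elim auto
      qed
      have "(\<lambda>N. qpoch q N * qpoch q (2 * N) * inverse (qpoch q (nat (int N + n)))
          * inverse (qpoch q (nat (int N + - n))) * theta_term q x n)
          \<longlonglongrightarrow> P * P * inverse P * inverse P * theta_term q x n"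
        by (intro tendsto_mult tendsto_inverse tendsto_const P lim
            filterlim_compose[OF lim N2] filterlim_compose[OF lim shift])
      moreover have "eventually (\<lambda>N. qpoch q N * qpoch q (2 * N) * inverse (qpoch q (nat (int N + n)))
          * inverse (qpoch q (nat (int N + - n))) * theta_term q x n = a N n) sequentially"
        using eventually_ge_at_top[of "nat \<bar>n\<bar>"]
        by eventually_elim (subst a_eq, auto)
      moreover have "P * P * inverse P * inverse P = 1" using P by (simp add: field_simps)
      ultimately show ?thesis
        by (simp cong: filterlim_cong add: tendsto_cong)
    qed
  qed auto
  then show ?thesis .
qed

subsection \<open>Dissection of the pentagonal number series\<close>

text \<open>The exponents left out of the product in \<open>ch\<close>. They are collected because
  the product over them, not over the remaining ones, is a theta series.\<close>

definition excluded :: "nat \<Rightarrow> nat \<Rightarrow> nat set" where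
  "excluded M i = {n. n \<ge> 1 \<and> ([int n = 0] (mod int M) \<or> [int n = int i] (mod int M)
      \<or> [int n = - int i] (mod int M))}"

lemma excluded_block:
  assumes "0 < i" "i < M" "1 \<le> r" "r \<le> M"
  shows "M * N + r \<in> excluded M i \<longleftrightarrow> r \<in> {i, M - i, M}"
proof -
  have shift: "[int (M * N + r) = c] (mod int M) \<longleftrightarrow> int M dvd int r - c" for c
  proof -
    have "int (M * N + r) - c = int M * int N + (int r - c)" by simp
    then show ?thesis by (metis cong_iff_dvd_diff dvd_add_right_iff dvd_triv_left)
  qed
  have 1: "int M dvd int r - 0 \<longleftrightarrow> r = M"
    using assms by (auto dest: zdvd_imp_le)
  have 2: "int M dvd int r - int i \<longleftrightarrow> r = i"
  proof
    assume *: "int M dvd int r - int i"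
    show "r = i"
    proof (rule ccontr)
      assume "r \<noteq> i"
      then have "int M \<le> \<bar>int r - int i\<bar>"
        using dvd_imp_le_int[OF _ *] by simp
      then show False using assms by auto
    qed
  qed auto
  have 3: "int M dvd int r - - int i \<longleftrightarrow> r = M - i"
  proof
    assume "int M dvd int r - - int i"
    then obtain c where c: "int r + int i = int M * c" by (auto simp: dvd_def)
    have "0 < int M * c" "int M * c < int M * 2" using assms unfolding c[symmetric] by auto
    then have "c = 1" using assms by (simp add: zero_less_mult_iff)
    then show "r = M - i" using c by simp
  next
    assume "r = M - i"
    then have "int r - - int i = int M" using assms by simp
    then show "int M dvd int r - - int i" by simp
  qed
  show ?thesis
    unfolding excluded_def mem_Collect_eq shift 1 2 3 using assms by auto
qed

text \<open>Each block of \<open>M\<close> consecutive exponents contains three excluded ones, with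
  residues \<open>i\<close>, \<open>M - i\<close> and \<open>M\<close>; they yield the three factors
  of the triple product with base \<open>w^M\<close> and \<open>x = w^i\<close>. The condition
  \<open>2 * i \<noteq> M\<close> keeps the first two apart.\<close>

lemma prod_excluded:
  fixes w :: complex
  assumes w: "w \<noteq> 0" and i: "0 < i" "i < M" "2 * i \<noteq> M"
  shows "(\<Prod>n\<le>M * N. if n \<in> excluded M i then 1 - w ^ n else 1) =
    (\<Prod>j<N. (1 - (w ^ M) ^ Suc j) * (1 - w ^ i * (w ^ M) ^ j) * (1 - (w ^ M) ^ Suc j / w ^ i))"
proof (induction N)
  case 0
  then show ?case by (simp add: excluded_def)
next
  case (Suc N)
  let ?f = "\<lambda>n. if n \<in> excluded M i then 1 - w ^ n else 1"
  have "(\<Prod>n\<le>M * Suc N. ?f n) = (\<Prod>n\<le>M * N. ?f n) * (\<Prod>n\<in>{M * N + 1..M * N + M}. ?f n)"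
    by (subst prod.union_disjoint[symmetric]) (auto intro!: prod.cong)
  also have "(\<Prod>n\<in>{M * N + 1..M * N + M}. ?f n) = (\<Prod>r\<in>{1..M}. ?f (M * N + r))"
    by (rule prod.reindex_bij_witness[of _ "\<lambda>r. M * N + r" "\<lambda>n. n - M * N"]) auto
  also have "\<dots> = (\<Prod>r\<in>{1..M}. if r \<in> {i, M - i, M} then 1 - w ^ (M * N + r) else 1)"
    by (intro prod.cong refl if_cong excluded_block i) auto
  also have "\<dots> = (\<Prod>r\<in>{i, M - i, M}. 1 - w ^ (M * N + r))"
    by (rule prod.mono_neutral_cong_right) (use i in auto)
  also have "\<dots> = (1 - w ^ (M * N + i)) * (1 - w ^ (M * N + (M - i))) * (1 - w ^ (M * N + M))"
    using i by simp
  also have "w ^ (M * N + i) = w ^ i * (w ^ M) ^ N"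
    by (simp add: power_add power_mult)
  also have "w ^ (M * N + (M - i)) = (w ^ M) ^ Suc N / w ^ i"
    using w i by (simp add: power_add power_mult power_diff)
  also have "w ^ (M * N + M) = (w ^ M) ^ Suc N"
    by (simp add: power_add power_mult)
  finally show ?case unfolding Suc by (simp only: prod.lessThan_Suc ac_simps)
qed

lemma euler_prod_excluded:
  assumes w: "w \<noteq> 0" "norm w < 1" and i: "0 < i" "i < M" "2 * i \<noteq> M"
  shows "euler_prod (excluded M i) w = infsum (theta_term (w ^ M) (w ^ i)) UNIV"
proof (rule LIMSEQ_unique)
  have "strict_mono (\<lambda>N. M * N)" using i by (auto simp: strict_mono_def)
  from LIMSEQ_subseq_LIMSEQ[OF euler_prod_lim[OF w(2), of "excluded M i"] this]
  show "(\<lambda>N. \<Prod>n\<le>M * N. if n \<in> excluded M i then 1 - w ^ n else 1) \<longlonglongrightarrow> euler_prod (excluded M i) w"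
    by (simp add: o_def)
  have "norm (w ^ M) < 1"
    using w i by (simp add: norm_power power_less_one_iff)
  then show "(\<lambda>N. \<Prod>n\<le>M * N. if n \<in> excluded M i then 1 - w ^ n else 1)
      \<longlonglongrightarrow> infsum (theta_term (w ^ M) (w ^ i)) UNIV"
    unfolding prod_excluded[OF w(1) i] by (rule jacobi_triple_product) (use w in auto)
qed

text \<open>This makes Euler's full product the case \<open>M = 3\<close>, \<open>i = 1\<close> of
  the triple product, which is the pentagonal number theorem.\<close>

lemma excluded_3_1: "excluded 3 1 = {1..}"
proof -
  have "[int n = 0] (mod 3) \<or> [int n = 1] (mod 3) \<or> [int n = - 1] (mod 3)" for n
  proof -
    have "int n mod 3 = 0 \<or> int n mod 3 = 1 \<or> int n mod 3 = 2" by presburger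
    then show ?thesis by (auto simp: cong_def)
  qed
  then show ?thesis by (auto simp: excluded_def)
qed

lemma theta_term_power:
  assumes "w \<noteq> 0"
  shows "theta_term (w ^ M) (w ^ i) n = (-1) powi n * w powi (int i * n + int M * (n * (n - 1) div 2))"
proof -
  have "(- (w ^ i)) powi n = (-1) powi n * (w ^ i) powi n"
    using power_int_mult_distrib[of "-1" "w ^ i" n] by simp
  then show ?thesis
    using assms by (simp add: theta_term_def power_int_add power_int_power)
qed

text \<open>The left side is the pentagonal number \<open>n (3 n - 1) / 2\<close> at
  \<open>n = s m + r\<close>. Its part linear in \<open>m\<close>, once
  \<open>3 s^2 m (m - 1) / 2\<close> is split off, has coefficient
  \<open>s (3 s + 6 r - 1) / 2\<close>, which for \<open>s = 2 u + 1\<close> is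
  \<open>s (3 (r + u) + 1)\<close>.\<close>

lemma pentagonal_dissection_exponent:
  fixes u r m :: int
  defines "s \<equiv> 2 * u + 1"
  shows "(s * m + r) + 3 * ((s * m + r) * (s * m + r - 1) div 2) =
    (s * (3 * (r + u) + 1)) * m + (3 * s\<^sup>2) * (m * (m - 1) div 2) + (r + 3 * (r * (r - 1) div 2))"
proof -
  have tri: "\<exists>a. n * (n - 1) = 2 * a" for n :: int
    using dvd_def[of 2 "n * (n - 1)"] by simp
  obtain a b c where abc: "m * (m - 1) = 2 * a" "r * (r - 1) = 2 * b"
      "(s * m + r) * (s * m + r - 1) = 2 * c"
    using tri by metis
  have "2 * ((s * m + r) + 3 * c) = 2 * (s * m + r) + 3 * ((s * m + r) * (s * m + r - 1))"
    unfolding abc by simp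
  also have "\<dots> = 2 * (s * (3 * (r + u) + 1) * m + r) + 3 * s\<^sup>2 * (m * (m - 1)) + 3 * (r * (r - 1))"
    by (simp add: s_def algebra_simps power2_eq_square)
  also have "\<dots> = 2 * ((s * (3 * (r + u) + 1)) * m + (3 * s\<^sup>2) * a + (r + 3 * b))"
    unfolding abc by (simp add: algebra_simps)
  finally have "(s * m + r) + 3 * c = (s * (3 * (r + u) + 1)) * m + (3 * s\<^sup>2) * a + (r + 3 * b)"
    by simp
  then show ?thesis unfolding abc by simp
qed

text \<open>Splitting the index of the pentagonal number series into residue classes modulo \<open>s\<close>
  turns each class into a theta series, hence into a triple product with modulus \<open>3s\<^sup>2\<close>.\<close>

lemma pentagonal_dissection:
  fixes w :: complex and u :: nat
  assumes w: "w \<noteq> 0" "norm w < 1"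
  defines "s \<equiv> 2 * u + 1"
  shows "euler_prod {1..} w = (\<Sum>r\<in>{-int u..int u}. (-1) powi r * w powi (r + 3 * (r * (r - 1) div 2))
     * euler_prod (excluded (3 * s\<^sup>2) (s * (3 * nat (r + int u) + 1))) w)"
proof -
  define S where "S = {- int u..int u} \<times> (UNIV :: int set)"
  define T where "T = theta_term (w ^ 3) (w ^ 1)"
  define i where "i r = s * (3 * nat (r + int u) + 1)" for r
  have s: "s > 0" "int s = 2 * int u + 1" by (auto simp: s_def)
  have pow: "norm (w ^ M) < 1" if "M > 0" for M
    using w that by (simp add: norm_power power_less_one_iff)
  have T: "(T has_sum euler_prod {1..} w) UNIV"
  proof -
    have "euler_prod {1..} w = infsum T UNIV"
      using euler_prod_excluded[OF w, of 1 3] by (simp add: T_def excluded_3_1[simplified])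
    moreover have "(T has_sum infsum T UNIV) UNIV"
      unfolding T_def
      by (rule has_sum_infsum[OF abs_summable_summable[OF theta_term_summable]]) (use w pow[of 3] in auto)
    ultimately show ?thesis by simp
  qed
  \<comment> \<open>Adding \<open>u\<close> before taking \<open>div\<close> and \<open>mod\<close>
    produces the centred residues from \<open>-u\<close> to \<open>u\<close>.\<close>
  have split: "((\<lambda>(r, m). T (int s * m + r)) has_sum euler_prod {1..} w) S"
    using T
  proof (subst has_sum_reindex_bij_witness[where S = S and T = UNIV and h = T
        and i = "\<lambda>n. ((n + int u) mod int s - int u, (n + int u) div int s)"
        and j = "\<lambda>(r, m). int s * m + r"])
    fix a assume "a \<in> S"
    then obtain r m where a: "a = (r, m)" "0 \<le> r + int u" "r + int u < int s"
      using s by (auto simp: S_def)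
    have "(int s * m + r + int u) div int s = m" "(int s * m + r + int u) mod int s = r + int u"
      using a s by (simp_all add: add.assoc)
    show "(((case a of (r, m) \<Rightarrow> int s * m + r) + int u) mod int s - int u,
            ((case a of (r, m) \<Rightarrow> int s * m + r) + int u) div int s) = a"
      using \<open>(int s * m + r + int u) div int s = m\<close> \<open>(int s * m + r + int u) mod int s = r + int u\<close> a by simp
  next
    fix n :: int
    show "((n + int u) mod int s - int u, (n + int u) div int s) \<in> S"
      using s pos_mod_bound[of "int s" "n + int u"] pos_mod_sign[of "int s" "n + int u"] by (simp add: S_def)
  next
    fix n :: int
    show "(case ((n + int u) mod int s - int u, (n + int u) div int s) of (r, m) \<Rightarrow> int s * m + r) = n"
      using mult_div_mod_eq[of "int s" "n + int u"] unfolding prod.case by linarith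
  qed auto
  have fiber: "((\<lambda>m. (\<lambda>(r, m). T (int s * m + r)) (r, m)) has_sum
      (-1) powi r * w powi (r + 3 * (r * (r - 1) div 2)) * euler_prod (excluded (3 * s\<^sup>2) (i r)) w) UNIV"
    if r: "r \<in> {-int u..int u}" for r
  proof -
    \<comment> \<open>The triple product requires \<open>0 < i r < 3 s^2\<close> and
      \<open>2 * i r\<close> different from \<open>3 s^2\<close>. The extreme residues give
      \<open>s\<close> and \<open>s (3 s - 2)\<close>, and the modulus is odd.\<close>
    have ir: "int (i r) = int s * (3 * (r + int u) + 1)" using r by (simp add: i_def algebra_simps)
    have "int (i r) \<le> int s * (3 * int s - 2)"
      unfolding ir using r s by (intro mult_left_mono) auto
    also have "\<dots> < int s * (3 * int s)" using s by (intro mult_strict_left_mono) auto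
    finally have "int (i r) < int (3 * s\<^sup>2)" by (simp add: power2_eq_square)
    then have lt: "i r < 3 * s\<^sup>2" by linarith
    have gt: "0 < i r" using s by (simp add: i_def)
    have "odd (3 * s\<^sup>2)" by (simp add: s_def)
    then have ne: "2 * i r \<noteq> 3 * s\<^sup>2" by (metis dvd_triv_left)
    have eq: "T (int s * m + r) = (-1) powi r * w powi (r + 3 * (r * (r - 1) div 2)) *
        theta_term (w ^ (3 * s\<^sup>2)) (w ^ i r) m" for m
    proof -
      \<comment> \<open>Oddness of \<open>s\<close> lets the sign of the index
        \<open>s m + r\<close> split into the signs of \<open>m\<close> and
        \<open>r\<close>.\<close>
      have "odd (int s)" by (simp add: s_def)
      then have sgn: "(-1) powi (int s * m + r) = (-1 :: complex) powi m * (-1) powi r"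
        by (cases "even m"; cases "even r") (simp_all add: power_int_add power_int_mult)
      moreover have ex: "int 1 * (int s * m + r) + int 3 * ((int s * m + r) * (int s * m + r - 1) div 2) =
          (int (i r) * m + int (3 * s\<^sup>2) * (m * (m - 1) div 2)) + (r + 3 * (r * (r - 1) div 2))"
        using pentagonal_dissection_exponent[of "int u" m r] unfolding ir s by (simp add: s)
      ultimately show ?thesis
        unfolding T_def theta_term_power[OF w(1)]
        by (simp only: power_int_add[OF disjI1[OF w(1)]] ac_simps)
    qed
    show ?thesis
      unfolding prod.case eq euler_prod_excluded[OF w gt lt ne]
      by (rule has_sum_cmult_right[OF has_sum_infsum[OF abs_summable_summable[OF theta_term_summable]]])
         (use w gt lt s pow[of "3 * s\<^sup>2"] in auto)
  qed
  have "((\<lambda>r. (-1) powi r * w powi (r + 3 * (r * (r - 1) div 2)) * euler_prod (excluded (3 * s\<^sup>2) (i r)) w)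
      has_sum euler_prod {1..} w) {-int u..int u}"
    by (rule has_sum_Sigma'[OF split[unfolded S_def] fiber])
  then show ?thesis
    unfolding i_def by (subst (asm) has_sum_finite_iff) auto
qed

subsection \<open>Leading coefficients of \<open>q\<close>-expansions\<close>

lemma qpow_add: "qpow (a + b) z = qpow a z * qpow b z"
  by (simp add: qpow_def of_rat_add ring_distribs flip: exp_add)

lemma qpow_0 [simp]: "qpow 0 z = 1"
  by (simp add: qpow_def)

lemma qpow_nonzero [simp]: "qpow a z \<noteq> 0"
  by (simp add: qpow_def)

lemma qpow_diff: "qpow (a - b) z = qpow a z / qpow b z"
  using qpow_add[of "a - b" b z] by simp

lemma qpow_of_nat: "qpow 1 z ^ n = qpow (of_nat n) z"
  by (induction n) (simp_all add: qpow_add)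

lemma qpow_of_int: "qpow 1 z powi n = qpow (of_int n) z"
proof (cases "n \<ge> 0")
  case True
  then show ?thesis using qpow_of_nat[of z "nat n"] by (simp add: power_int_def)
next
  case False
  then have "qpow 1 z powi n = inverse (qpow (of_nat (nat (- n))) z)"
    by (simp add: power_int_def qpow_of_nat power_inverse)
  also have "\<dots> = qpow (0 - of_nat (nat (- n))) z"
    unfolding qpow_diff by (simp add: inverse_eq_divide)
  finally show ?thesis using False by simp
qed

lemma qpow_sum: "qpow (\<Sum>j\<in>J. e j) z = (\<Prod>j\<in>J. qpow (e j) z)"
  by (induction J rule: infinite_finite_induct) (simp_all add: qpow_add)

lemma norm_qpow: "norm (qpow a z) = exp (- (2 * pi * real_of_rat a * Im z))"
proof -
  have "Re (2 * complex_of_real pi * \<i> * of_rat a * z) = - (2 * pi * real_of_rat a * Im z)"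
  proof -
    have "(of_rat a :: complex) = of_real (of_rat a)"
      by (cases a) (simp add: of_rat_rat)
    then show ?thesis by (simp add: mult.assoc)
  qed
  then show ?thesis by (simp add: qpow_def)
qed

lemma norm_qpow_1: "z \<in> upper_half_plane \<Longrightarrow> norm (qpow 1 z) < 1"
  by (simp add: norm_qpow upper_half_plane_def)

lemma has_field_derivative_qpow:
  "(qpow a has_field_derivative 2 * of_real pi * \<i> * of_rat a * qpow a z) (at z)"
  unfolding qpow_def by (auto intro!: derivative_eq_intros)

lemma open_upper_half_plane: "open upper_half_plane"
  unfolding upper_half_plane_def by (rule open_halfspace_Im_gt)

section \<open>Functions of the form q^e g(q)\<close>

text \<open>The rational exponent is isolated in \<open>e\<close>, so that derivatives and
  determinants can be computed on \<open>g\<close> in the disc. Agreement is asked only on the upper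
  half-plane, where the product in \<open>ch\<close> is known to converge.\<close>

definition q_factored :: "rat \<Rightarrow> (complex \<Rightarrow> complex) \<Rightarrow> (complex \<Rightarrow> complex) \<Rightarrow> bool" where
  "q_factored e g f \<longleftrightarrow> g holomorphic_on ball 0 1 \<and>
     (\<forall>z\<in>upper_half_plane. f z = qpow e z * g (qpow 1 z))"

lemma has_field_derivative_q_factored:
  assumes "q_factored e g f" "z \<in> upper_half_plane"
  shows "(f has_field_derivative 2 * of_real pi * \<i> *
    (qpow e z * (of_rat e * g (qpow 1 z) + qpow 1 z * deriv g (qpow 1 z)))) (at z)"
proof -
  have "(g has_field_derivative deriv g (qpow 1 z)) (at (qpow 1 z))"
    using assms norm_qpow_1[OF assms(2)]
    by (intro holomorphic_derivI[of g "ball 0 1"]) (auto simp: q_factored_def)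
  from DERIV_chain2[OF this has_field_derivative_qpow]
  have "((\<lambda>z. qpow e z * g (qpow 1 z)) has_field_derivative
      2 * of_real pi * \<i> * of_rat e * qpow e z * g (qpow 1 z) +
      deriv g (qpow 1 z) * (2 * of_real pi * \<i> * of_rat 1 * qpow 1 z) * qpow e z) (at z)"
    by (rule DERIV_mult[OF has_field_derivative_qpow])
  then have "((\<lambda>z. qpow e z * g (qpow 1 z)) has_field_derivative 2 * of_real pi * \<i> *
    (qpow e z * (of_rat e * g (qpow 1 z) + qpow 1 z * deriv g (qpow 1 z)))) (at z)"
    by (simp add: algebra_simps)
  then show ?thesis
    using assms by (elim has_field_derivative_transform_within_open[OF _ open_upper_half_plane])
      (auto simp: q_factored_def)
qed

text \<open>The operator that \<open>q d/dq\<close> induces on the factor \<open>g\<close> of \<open>q\<^sup>e g(q)\<close>.\<close>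

definition euler_op :: "rat \<Rightarrow> (complex \<Rightarrow> complex) \<Rightarrow> complex \<Rightarrow> complex" where
  "euler_op e g = (\<lambda>w. of_rat e * g w + w * deriv g w)"

lemma q_factored_qderiv:
  assumes "q_factored e g f"
  shows "q_factored e (euler_op e g) (qderiv f)"
proof -
  have "euler_op e g holomorphic_on ball 0 1"
    using assms unfolding euler_op_def q_factored_def by (auto intro!: holomorphic_intros)
  moreover have "qderiv f z = qpow e z * euler_op e g (qpow 1 z)" if "z \<in> upper_half_plane" for z
    using DERIV_imp_deriv[OF has_field_derivative_q_factored[OF assms that]]
    by (simp add: qderiv_def euler_op_def)
  ultimately show ?thesis by (simp add: q_factored_def)
qed

lemma q_factored_qderiv_iter:
  "q_factored e g f \<Longrightarrow> q_factored e ((euler_op e ^^ m) g) ((qderiv ^^ m) f)"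
  by (induction m) (simp_all add: q_factored_qderiv)

text \<open>The summand with the factor \<open>w\<close> dies at 0. The constant terms of iterated
  derivatives are therefore powers of the exponent, the entries of a Vandermonde matrix.\<close>

lemma euler_op_iter_0: "(euler_op e ^^ m) g 0 = of_rat e ^ m * g 0"
  by (induction m) (simp_all add: euler_op_def)

lemma q_factored_cmult: "q_factored e g f \<Longrightarrow> q_factored e (\<lambda>w. c * g w) (\<lambda>z. c * f z)"
  by (auto simp: q_factored_def intro!: holomorphic_intros)

text \<open>Every term of the Leibniz formula takes one entry from each column, so all terms share
  the prefactor with exponent \<open>\<Sum>j<k. e j\<close>.\<close>

lemma q_factored_det:
  assumes "\<And>m j. m < k \<Longrightarrow> j < k \<Longrightarrow> q_factored (e j) (g m j) (f m j)"
  shows "q_factored (\<Sum>j<k. e j)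
    (\<lambda>w. Determinant.det (Matrix.mat k k (\<lambda>(m, j). g m j w)))
    (\<lambda>z. Determinant.det (Matrix.mat k k (\<lambda>(m, j). f m j z)))"
proof -
  have det: "Determinant.det (Matrix.mat k k (\<lambda>(m, j). h m j)) =
      (\<Sum>p | p permutes {0..<k}. signof p * (\<Prod>i<k. h i (p i)))" for h :: "nat \<Rightarrow> nat \<Rightarrow> complex"
    by (subst det_def'[of _ k]) (auto intro!: sum.cong prod.cong simp: atLeast0LessThan permutes_in_image)
  have lt: "p i < k" if "p permutes {0..<k}" "i < k" for p i
    using that permutes_in_image[of p "{0..<k}" i] by auto
  show ?thesis
    unfolding q_factored_def det
  proof (intro conjI ballI)
    show "(\<lambda>w. \<Sum>p | p permutes {0..<k}. signof p * (\<Prod>i<k. g i (p i) w)) holomorphic_on ball 0 1"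
      using assms lt by (intro holomorphic_intros) (auto simp: q_factored_def)
    fix z assume z: "z \<in> upper_half_plane"
    have "(\<Prod>i<k. f i (p i) z) = qpow (\<Sum>j<k. e j) z * (\<Prod>i<k. g i (p i) (qpow 1 z))"
      if p: "p permutes {0..<k}" for p
    proof -
      have "(\<Prod>i<k. f i (p i) z) = (\<Prod>i<k. qpow (e (p i)) z * g i (p i) (qpow 1 z))"
        using assms lt[OF p] z by (intro prod.cong) (auto simp: q_factored_def)
      also have "\<dots> = (\<Prod>i<k. qpow (e (p i)) z) * (\<Prod>i<k. g i (p i) (qpow 1 z))"
        by (rule prod.distrib)
      also have "(\<Prod>i<k. qpow (e (p i)) z) = (\<Prod>j<k. qpow (e j) z)"
        using p prod.permute[of p "{0..<k}" "\<lambda>j. qpow (e j) z"] by (simp add: o_def atLeast0LessThan)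
      finally show ?thesis by (simp add: qpow_sum)
    qed
    then show "(\<Sum>p | p permutes {0..<k}. signof p * (\<Prod>i<k. f i (p i) z)) =
        qpow (\<Sum>j<k. e j) z * (\<Sum>p | p permutes {0..<k}. signof p * (\<Prod>i<k. g i (p i) (qpow 1 z)))"
      by (simp add: sum_distrib_left mult.left_commute)
  qed
qed

text \<open>The Taylor coefficients of \<open>g\<close> are placed at the exponents
  \<open>e + n\<close>, with 0 at all other rationals. Convergence at some \<open>t\<close> between
  \<open>norm w\<close> and 1 gives the absolute convergence behind \<open>has_sum\<close>.\<close>

lemma has_leading_coeff_q_factored:
  assumes f: "q_factored e g f" and g0: "g 0 \<noteq> 0"
  shows "has_leading_coeff f (g 0)"
proof -
  define c where "c n = (deriv ^^ n) g 0 / fact n" for n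
  define a where "a r = (if r \<in> range (\<lambda>n. e + of_nat n) then c (nat \<lfloor>r - e\<rfloor>) else 0)" for r
  have hol: "g holomorphic_on ball 0 1" using f by (simp add: q_factored_def)
  have sums: "(\<lambda>n. c n * w ^ n) sums g w" if "norm w < 1" for w
    using holomorphic_power_series[OF hol, of w] that by (simp add: c_def)
  have a_shift: "a (e + of_nat n) = c n" for n by (simp add: a_def)
  have "((\<lambda>r. a r * qpow r z) has_sum f z) UNIV" if z: "z \<in> upper_half_plane" for z
  proof -
    define w where "w = qpow 1 z"
    obtain t where t: "norm w < t" "t < 1"
      using norm_qpow_1[OF z] dense unfolding w_def by blast
    have t0: "0 \<le> t" using t(1) norm_ge_zero[of w] by linarith
    have "summable (\<lambda>n. norm (c n * w ^ n))"
      by (rule powser_insidea[of _ "of_real t"])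
         (use sums[of "of_real t"] t t0 in \<open>auto simp: sums_iff\<close>)
    then have "((\<lambda>n. c n * w ^ n) has_sum g w) UNIV"
      using sums[of w] t by (intro norm_summable_imp_has_sum) auto
    then have "((\<lambda>n. qpow e z * (c n * w ^ n)) has_sum f z) UNIV"
      using f z has_sum_cmult_right[of "\<lambda>n. c n * w ^ n" UNIV "g w" "qpow e z"]
      by (simp add: q_factored_def w_def)
    also have "(\<lambda>n. qpow e z * (c n * w ^ n)) = (\<lambda>r. a r * qpow r z) \<circ> (\<lambda>n. e + of_nat n)"
      by (auto simp: fun_eq_iff a_shift qpow_add w_def qpow_of_nat)
    finally have "((\<lambda>r. a r * qpow r z) has_sum f z) (range (\<lambda>n. e + of_nat n))"
      by (subst has_sum_reindex) (auto simp: inj_on_def o_def)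
    then show ?thesis
      by (subst (asm) has_sum_cong_neutral[where T = UNIV and g = "\<lambda>r. a r * qpow r z"]) (auto simp: a_def)
  qed
  moreover have "a e = g 0" using a_shift[of 0] by (simp add: c_def)
  moreover have "a r = 0" if "r < e" for r
  proof -
    have "r \<notin> range (\<lambda>n. e + of_nat n)" using that by auto
    then show ?thesis by (simp add: a_def)
  qed
  ultimately show ?thesis
    using g0 unfolding has_leading_coeff_def has_q_expansion_def by blast
qed

section \<open>Uniqueness of the leading coefficient\<close>

lemma imaginary_axis_upper_half_plane: "y > 0 \<Longrightarrow> \<i> * complex_of_real y \<in> upper_half_plane"
  by (simp add: upper_half_plane_def)

lemma qpow_tendsto_0:
  assumes "r > 0"
  shows "((\<lambda>y. qpow r (\<i> * complex_of_real y)) \<longlongrightarrow> 0) at_top"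
proof (rule tendsto_norm_zero_cancel)
  have "2 * pi * real_of_rat r > 0" using assms by simp
  then have "filterlim (\<lambda>y. 2 * pi * real_of_rat r * y) at_top at_top"
    by (intro filterlim_tendsto_pos_mult_at_top[OF tendsto_const _ filterlim_ident]) auto
  then show "((\<lambda>y. norm (qpow r (\<i> * complex_of_real y))) \<longlongrightarrow> 0) at_top"
    unfolding norm_qpow
    by (intro filterlim_compose[OF exp_at_bot] filterlim_compose[OF filterlim_uminus_at_bot_at_top]) simp
qed

text \<open>Along \<open>z = i y\<close> every \<open>q^r\<close> with \<open>r > 0\<close> tends to
  0. The exponents of an arbitrary expansion may accumulate at \<open>n\<close>, so no uniform gap
  is available; instead the terms for \<open>y \<ge> 1\<close> are dominated by their values at
  \<open>z = i\<close>.\<close>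

lemma q_expansion_limit:
  assumes f: "has_q_expansion f a" and a: "\<And>m. m < n \<Longrightarrow> a m = 0"
  shows "((\<lambda>y. f (\<i> * complex_of_real y) / qpow n (\<i> * complex_of_real y)) \<longlongrightarrow> a n) at_top"
proof -
  define c where "c r = (if r = n then a n else 0)" for r
  have "((\<lambda>y. f (\<i> * complex_of_real y) / qpow n (\<i> * complex_of_real y)) \<longlongrightarrow> infsum c UNIV) at_top"
  proof (rule has_sum_tannery[where f = "\<lambda>r y. a r * qpow (r - n) (\<i> * complex_of_real y)"
        and M = "\<lambda>r. norm (a r * qpow (r - n) \<i>)"])
    have le: "norm (a r * qpow (r - n) (\<i> * complex_of_real y)) \<le> norm (a r * qpow (r - n) \<i>)"
      if y: "y \<ge> 1" for y :: real and r
    proof (cases "r < n")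
      case False
      then have "0 \<le> real_of_rat (r - n)" by simp
      then have "real_of_rat (r - n) * 1 \<le> real_of_rat (r - n) * y"
        using y by (intro mult_left_mono)
      then show ?thesis
        by (simp add: norm_mult norm_qpow mult_left_mono mult.assoc)
    qed (simp add: a)
    show "\<forall>\<^sub>F y in at_top. \<forall>r\<in>UNIV. norm (a r * qpow (r - n) (\<i> * complex_of_real y)) \<le> norm (a r * qpow (r - n) \<i>)"
      using eventually_ge_at_top[of "1::real"] by eventually_elim (use le in auto)
    have sum: "((\<lambda>r. a r * qpow (r - n) z) has_sum f z / qpow n z) UNIV" if "z \<in> upper_half_plane" for z
    proof -
      have "((\<lambda>r. a r * qpow r z * inverse (qpow n z)) has_sum f z * inverse (qpow n z)) UNIV"
        using f that by (intro has_sum_cmult_left) (auto simp: has_q_expansion_def)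
      then show ?thesis by (simp add: qpow_diff divide_inverse mult.assoc)
    qed
    show "(\<lambda>r. norm (a r * qpow (r - n) \<i>)) summable_on UNIV"
      using sum[of \<i>] summable_on_iff_abs_summable_on_complex has_sum_imp_summable
      by (fastforce simp: upper_half_plane_def)
    show "\<forall>\<^sub>F y in at_top. ((\<lambda>r. a r * qpow (r - n) (\<i> * complex_of_real y)) has_sum
        f (\<i> * complex_of_real y) / qpow n (\<i> * complex_of_real y)) UNIV"
      using eventually_gt_at_top[of "0::real"]
      by eventually_elim (intro sum imaginary_axis_upper_half_plane)
    show "((\<lambda>y. a r * qpow (r - n) (\<i> * complex_of_real y)) \<longlongrightarrow> c r) at_top" for r
    proof -
      consider "r < n" | "r = n" | "r > n" by linarith
      then show ?thesis
      proof cases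
        case 3
        then show ?thesis
          using tendsto_mult_right_zero[OF qpow_tendsto_0[of "r - n"], of "a r"] by (simp add: c_def)
      qed (simp_all add: a c_def)
    qed
  qed auto
  moreover have "(c has_sum a n) UNIV"
    by (rule has_sum_finite_neutralI[of "{n}"]) (auto simp: c_def)
  ultimately show ?thesis by (simp add: infsumI)
qed

text \<open>If the leading exponents of two expansions differed, the limit at the smaller one would
  be nonzero by one expansion and 0 by the other. At the common exponent, both coefficients are the
  same limit.\<close>

lemma has_leading_coeff_unique:
  assumes "has_leading_coeff f c" "has_leading_coeff f c'"
  shows "c = c'"
proof -
  have uniq: "n' \<le> n" if "has_q_expansion f a" "a n \<noteq> 0" "\<And>m. m < n \<Longrightarrow> a m = 0"
    "has_q_expansion f a'" "\<And>m. m < n' \<Longrightarrow> a' m = 0" for a a' n n'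
  proof (rule ccontr)
    assume "\<not> n' \<le> n"
    then have "a' n = 0" "\<And>m. m < n \<Longrightarrow> a' m = 0" using that(5) by auto
    then show False
      using tendsto_unique[OF _ q_expansion_limit[OF that(1,3)] q_expansion_limit[OF that(4)]] that(2)
      by auto
  qed
  obtain a n where a: "has_q_expansion f a" "a n = c" "c \<noteq> 0" "\<And>m. m < n \<Longrightarrow> a m = 0"
    using assms(1) by (auto simp: has_leading_coeff_def)
  obtain a' n' where a': "has_q_expansion f a'" "a' n' = c'" "c' \<noteq> 0" "\<And>m. m < n' \<Longrightarrow> a' m = 0"
    using assms(2) by (auto simp: has_leading_coeff_def)
  have "n = n'"
    using uniq[of a n a' n'] uniq[of a' n' a n] a a' by force
  then show ?thesis
    using tendsto_unique[OF _ q_expansion_limit[OF a(1,4)] q_expansion_limit[OF a'(1,4)]] a(2) a'(2) by auto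
qed

lemma not_has_leading_coeff_0: "\<not> has_leading_coeff (\<lambda>z. 0) c"
proof
  assume "has_leading_coeff (\<lambda>z. 0) c"
  then obtain a n where a: "has_q_expansion (\<lambda>z. 0) a" "a n = c" "c \<noteq> 0" "\<And>m. m < n \<Longrightarrow> a m = 0"
    by (auto simp: has_leading_coeff_def)
  have "((\<lambda>y::real. 0) \<longlongrightarrow> c) at_top"
    using q_expansion_limit[OF a(1), of n] a(2,4) by simp
  then show False using a(3) by (simp add: tendsto_const_iff)
qed

text \<open>Evaluates the \<open>THE\<close> in \<open>alpha\<close> and \<open>beta\<close>. A
  competing constant is nonzero because the zero function has no leading coefficient, and then
  uniqueness fixes it.\<close>

lemma normalizing_constant:
  assumes f: "q_factored e g f" and g0: "g 0 \<noteq> 0"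
  shows "(THE c. has_leading_coeff (\<lambda>z. c * f z) 1) = 1 / g 0"
proof (rule the_equality)
  have scale: "has_leading_coeff (\<lambda>z. c * f z) (c * g 0)" if "c \<noteq> 0" for c
    using has_leading_coeff_q_factored[OF q_factored_cmult[OF f], of c] that g0 by simp
  show "has_leading_coeff (\<lambda>z. 1 / g 0 * f z) 1"
    using scale[of "1 / g 0"] g0 by simp
  fix c assume c: "has_leading_coeff (\<lambda>z. c * f z) 1"
  then have "c \<noteq> 0" using not_has_leading_coeff_0[of 1] by auto
  then have "c * g 0 = 1" using has_leading_coeff_unique[OF scale c] by simp
  then show "c = 1 / g 0" using g0 by (simp add: field_simps)
qed

text \<open>Stated with "eventually" so that several functions can be made nonzero at one common
  point.\<close>

lemma q_factored_eventually_nonzero: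
  assumes f: "q_factored e g f" and g0: "g 0 \<noteq> 0"
  shows "\<forall>\<^sub>F y in at_top. f (\<i> * complex_of_real y) \<noteq> 0"
proof -
  have "isCont g 0"
    using f by (auto simp: q_factored_def intro!: continuous_on_interior[of "ball 0 1"] holomorphic_on_imp_continuous_on)
  then have "((\<lambda>y. g (qpow 1 (\<i> * complex_of_real y))) \<longlongrightarrow> g 0) at_top"
    by (rule isCont_tendsto_compose) (rule qpow_tendsto_0, simp)
  then have "\<forall>\<^sub>F y in at_top. g (qpow 1 (\<i> * complex_of_real y)) \<noteq> 0"
    using g0 tendsto_imp_eventually_ne by blast
  then show ?thesis
    using eventually_gt_at_top[of "0::real"]
    by eventually_elim (use f imaginary_axis_upper_half_plane in \<open>auto simp: q_factored_def\<close>)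
qed

subsection \<open>The characters and their Wronskians\<close>

definition ch_exponent :: "nat \<Rightarrow> nat \<Rightarrow> rat" where
  "ch_exponent i k = conf_weight i k - central_charge k / 24"

text \<open>The terms with \<open>(2k-1)^2\<close> in the conformal weight and in the central charge
  cancel, leaving a single square.\<close>

lemma ch_exponent_eq:
  "ch_exponent i k = (2 * of_nat k + 1 - 2 * of_nat i)\<^sup>2 / (8 * (2 * of_nat k + 1)) - 1 / 24"
proof -
  define M x :: rat where "M = 2 * of_nat k + 1" and "x = (2 * of_nat k - 1)\<^sup>2"
  have "M > 0" unfolding M_def by (intro add_nonneg_pos) auto
  then have "(M - 2 * of_nat i)\<^sup>2 / (8 * M) - 1 / 24 = ((M - 2 * of_nat i)\<^sup>2 - x) / (8 * M) - (1 - 3 * x / M) / 24"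
    by (simp add: divide_simps)
  then show ?thesis
    by (simp add: ch_exponent_def conf_weight_def central_charge_def M_def x_def algebra_simps)
qed

lemma inj_on_ch_exponent: "inj_on (\<lambda>i. ch_exponent i k) {1..k}"
proof (rule inj_onI)
  fix i j assume ij: "i \<in> {1..k}" "j \<in> {1..k}" and eq: "ch_exponent i k = ch_exponent j k"
  have M: "(8 * (2 * of_nat k + 1) :: rat) > 0" by (intro mult_pos_pos add_nonneg_pos) auto
  have sq: "(2 * of_nat k + 1 - 2 * of_nat i :: rat)\<^sup>2 = (2 * of_nat k + 1 - 2 * of_nat j)\<^sup>2"
  proof -
    have "a = b" if "a / D - c = b / D - c" "D > 0" for a b c D :: rat
      using that by simp
    from this[OF eq[unfolded ch_exponent_eq] M] show ?thesis .
  qed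
  have nonneg: "(0 :: rat) \<le> 2 * of_nat k + 1 - 2 * of_nat l" if "l \<le> k" for l
  proof -
    have "(of_nat l :: rat) \<le> of_nat k" using that by (rule of_nat_mono)
    then show ?thesis by linarith
  qed
  have "i \<le> k" "j \<le> k" using ij by auto
  from power2_eq_imp_eq[OF sq nonneg[OF this(1)] nonneg[OF this(2)]]
  show "i = j" by simp
qed

lemma ch_exponent_eq_0:
  assumes "ch_exponent i k = 0"
  shows "3 * (2 * int k + 1 - 2 * int i)\<^sup>2 = 2 * int k + 1"
proof -
  have M: "(2 * of_nat k + 1 :: rat) > 0" by (intro add_nonneg_pos) auto
  have "(2 * of_nat k + 1 - 2 * of_nat i :: rat)\<^sup>2 / (8 * (2 * of_nat k + 1)) = 1 / 24"
    using assms unfolding ch_exponent_eq by (simp only: right_minus_eq)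
  moreover have "3 * a = D" if "a / (8 * D) = 1 / 24" "D > 0" for a D :: rat
    using that by (simp add: field_simps)
  ultimately have "3 * (2 * of_nat k + 1 - 2 * of_nat i)\<^sup>2 = (2 * of_nat k + 1 :: rat)"
    using M by blast
  then have "rat_of_int (3 * (2 * int k + 1 - 2 * int i)\<^sup>2) = rat_of_int (2 * int k + 1)"
    by simp
  then show ?thesis by (simp only: of_int_eq_iff)
qed

lemma ch_eq:
  assumes "z \<in> upper_half_plane"
  shows "ch i k z = qpow (ch_exponent i k) z *
    (1 / euler_prod ({1..} - excluded (2 * k + 1) i) (qpow 1 z))"
proof -
  have "(n \<ge> 1 \<and> \<not> [int n = 0] (mod (2 * int k + 1)) \<and> \<not> [int n = int i] (mod (2 * int k + 1))
      \<and> \<not> [int n = - int i] (mod (2 * int k + 1))) \<longleftrightarrow> n \<in> {1..} - excluded (2 * k + 1) i" for n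
    by (auto simp: excluded_def ac_simps)
  then show ?thesis
    unfolding ch_def ch_exponent_def[symmetric]
    by (simp only: euler_prod_inverse[OF norm_qpow_1[OF assms]])
qed

text \<open>Passing to the complementary product puts a theta series in the numerator over a
  denominator common to all \<open>i\<close>; the linear relation is read off from this
  form.\<close>

lemma ch_eq':
  assumes "z \<in> upper_half_plane"
  shows "ch i k z = qpow (ch_exponent i k) z *
    euler_prod (excluded (2 * k + 1) i) (qpow 1 z) / euler_prod {1..} (qpow 1 z)"
proof -
  let ?q = "qpow 1 z" and ?X = "excluded (2 * k + 1) i"
  have "({1..} - ?X) \<union> ?X = {1..}" by (auto simp: excluded_def)
  then have "euler_prod {1..} ?q = euler_prod ({1..} - ?X) ?q * euler_prod ?X ?q"
    using euler_prod_Un[OF norm_qpow_1[OF assms], of "{1..} - ?X" ?X] by auto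
  moreover have "euler_prod ({1..} - ?X) ?q \<noteq> 0" "euler_prod ?X ?q \<noteq> 0"
    by (rule euler_prod_nonzero[OF norm_qpow_1[OF assms]]; auto simp: excluded_def)+
  ultimately show ?thesis unfolding ch_eq[OF assms] by simp
qed

text \<open>The dissection produces indices up to \<open>2 * k\<close>, whereas the determinants
  have columns only for \<open>1 \<le> i \<le> k\<close>; this symmetry folds the larger ones
  back.\<close>

lemma ch_reflect:
  assumes "z \<in> upper_half_plane" "i \<le> 2 * k + 1"
  shows "ch (2 * k + 1 - i) k z = ch i k z"
proof -
  have "[int (2 * k + 1 - i) = - int i] (mod int (2 * k + 1))"
       "[- int (2 * k + 1 - i) = int i] (mod int (2 * k + 1))"
  proof -
    have "int (2 * k + 1 - i) = int (2 * k + 1) - int i" using assms(2) by (rule of_nat_diff)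
    then have "int (2 * k + 1 - i) - - int i = int (2 * k + 1)"
        "- int (2 * k + 1 - i) - int i = - int (2 * k + 1)" by linarith+
    then show "[int (2 * k + 1 - i) = - int i] (mod int (2 * k + 1))"
       "[- int (2 * k + 1 - i) = int i] (mod int (2 * k + 1))"
      unfolding cong_iff_dvd_diff by (simp_all only: dvd_minus_iff dvd_refl)
  qed
  then have "[int n = int (2 * k + 1 - i)] (mod int (2 * k + 1)) \<longleftrightarrow> [int n = - int i] (mod int (2 * k + 1))"
       "[int n = - int (2 * k + 1 - i)] (mod int (2 * k + 1)) \<longleftrightarrow> [int n = int i] (mod int (2 * k + 1))" for n
    unfolding cong_def by metis+
  then have "excluded (2 * k + 1) (2 * k + 1 - i) = excluded (2 * k + 1) i"
    unfolding excluded_def by auto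
  moreover have "ch_exponent (2 * k + 1 - i) k = ch_exponent i k"
  proof -
    have "(2 * of_nat k + 1 - 2 * of_nat (2 * k + 1 - i) :: rat) = - (2 * of_nat k + 1 - 2 * of_nat i)"
      using assms(2) by (simp add: of_nat_diff)
    then show ?thesis unfolding ch_exponent_eq by (simp only: power2_minus)
  qed
  ultimately show ?thesis by (simp only: ch_eq[OF assms(1)])
qed

lemma q_factored_ch:
  "q_factored (ch_exponent i k) (\<lambda>w. 1 / euler_prod ({1..} - excluded (2 * k + 1) i) w) (ch i k)"
proof -
  have "euler_prod ({1..} - excluded (2 * k + 1) i) w \<noteq> 0" if "w \<in> ball 0 1" for w
    using that by (intro euler_prod_nonzero) auto
  then show ?thesis
    unfolding q_factored_def by (auto intro!: holomorphic_intros holomorphic_euler_prod simp: ch_eq)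
qed

section \<open>Nonvanishing and vanishing of the determinants\<close>

text \<open>A dependency among the rows is a polynomial with coefficients only below
  \<open>k\<close>; after cancelling \<open>e j ^ d\<close> it has the \<open>k\<close> distinct
  roots \<open>e j\<close>, hence is 0.\<close>

lemma generalized_vandermonde_nonzero:
  fixes e :: "nat \<Rightarrow> 'a :: field"
  assumes inj: "inj_on e {..<k}" and nz: "d = 0 \<or> (\<forall>j<k. e j \<noteq> 0)"
  shows "Determinant.det (Matrix.mat k k (\<lambda>(m, j). e j ^ (m + d))) \<noteq> 0"
proof
  define A where "A = Matrix.mat k k (\<lambda>(m, j). e j ^ (m + d))"
  assume "Determinant.det (Matrix.mat k k (\<lambda>(m, j). e j ^ (m + d))) = 0"
  then have "Determinant.det (transpose_mat A) = 0"
    by (subst det_transpose[of _ k]) (auto simp: A_def)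
  moreover have AT: "transpose_mat A \<in> carrier_mat k k" by (auto simp: A_def)
  ultimately obtain v where v: "v \<in> carrier_vec k" "v \<noteq> 0\<^sub>v k" "transpose_mat A *\<^sub>v v = 0\<^sub>v k"
    using det_0_iff_vec_prod_zero_field[OF AT] by auto
  define p where "p = (\<Sum>m<k. monom (vec_index v m) m)"
  have coeff: "coeff p m = (if m < k then vec_index v m else 0)" for m
    by (simp add: p_def coeff_sum)
  have root: "poly p (e j) = 0" if j: "j < k" for j
  proof -
    have "0 = vec_index (transpose_mat A *\<^sub>v v) j" using j v by simp
    also have "\<dots> = (\<Sum>m<k. e j ^ (m + d) * vec_index v m)"
      using j v(1) by (auto simp: A_def scalar_prod_def atLeast0LessThan intro!: sum.cong)
    also have "\<dots> = e j ^ d * poly p (e j)"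
      by (simp add: p_def poly_sum poly_monom sum_distrib_left power_add algebra_simps)
    finally show ?thesis using nz j by auto
  qed
  have "p = 0"
  proof (rule ccontr)
    assume "p \<noteq> 0"
    have "k = card (e ` {..<k})" using inj by (simp add: card_image)
    also have "\<dots> \<le> card {x. poly p x = 0}"
      using root \<open>p \<noteq> 0\<close> by (intro card_mono poly_roots_finite) auto
    also have "\<dots> \<le> degree p" by (rule card_poly_roots_bound[OF \<open>p \<noteq> 0\<close>])
    finally have "coeff p (degree p) = 0" by (simp add: coeff)
    then show False using \<open>p \<noteq> 0\<close> by simp
  qed
  then have "v = 0\<^sub>v k" using coeff v(1) by (intro eq_vecI) (auto, metis coeff_0)
  then show False using v(2) by simp
qed

lemma q_factored_wronskian:
  assumes "d = 0 \<or> (\<forall>i\<in>{1..k}. ch_exponent i k \<noteq> 0)"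
  shows "\<exists>e g. q_factored e g (\<lambda>z. Determinant.det
           (Matrix.mat k k (\<lambda>(m, j). (qderiv ^^ (m + d)) (ch (j + 1) k) z))) \<and> g 0 \<noteq> 0"
proof -
  define h where "h j = (\<lambda>w. 1 / euler_prod ({1..} - excluded (2 * k + 1) (j + 1)) w)" for j
  define e where "e j = ch_exponent (j + 1) k" for j
  define g where "g m j = (euler_op (e j) ^^ (m + d)) (h j)" for m j
  have g0: "g m j 0 = of_rat (e j) ^ (m + d)" for m j
    by (simp add: g_def euler_op_iter_0 h_def euler_prod_0)
  have "inj_on (\<lambda>j. complex_of_rat (e j)) {..<k}"
    using inj_onD[OF inj_on_ch_exponent[of k]] by (fastforce simp: inj_on_def e_def)
  then have "Determinant.det (Matrix.mat k k (\<lambda>(m, j). complex_of_rat (e j) ^ (m + d))) \<noteq> 0"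
    by (rule generalized_vandermonde_nonzero) (use assms in \<open>auto simp: e_def\<close>)
  then have "Determinant.det (Matrix.mat k k (\<lambda>(m, j). g m j 0)) \<noteq> 0"
    unfolding g0 .
  moreover have "q_factored (\<Sum>j<k. e j) (\<lambda>w. Determinant.det (Matrix.mat k k (\<lambda>(m, j). g m j w)))
     (\<lambda>z. Determinant.det (Matrix.mat k k (\<lambda>(m, j). (qderiv ^^ (m + d)) (ch (j + 1) k) z)))"
    unfolding g_def e_def h_def by (intro q_factored_det q_factored_qderiv_iter q_factored_ch)
  ultimately show ?thesis by blast
qed

text \<open>Both normalizing constants are reciprocals of nonzero leading coefficients, so it
  suffices to find one point high on the imaginary axis where neither determinant vanishes.\<close>

lemma F_not_identically_0:
  assumes "\<forall>i\<in>{1..k}. ch_exponent i k \<noteq> 0"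
  shows "\<exists>z\<in>upper_half_plane. F k z \<noteq> 0"
proof -
  obtain e g where g: "q_factored e g (wronskian_det k)" "g 0 \<noteq> 0"
    using q_factored_wronskian[of 0 k] by (auto simp: wronskian_det_def[abs_def])
  obtain e' g' where g': "q_factored e' g' (wronskian_det' k)" "g' 0 \<noteq> 0"
    using q_factored_wronskian[of 1 k] assms by (auto simp: wronskian_det'_def[abs_def])
  have "\<forall>\<^sub>F y in at_top. wronskian_det k (\<i> * complex_of_real y) \<noteq> 0 \<and>
      wronskian_det' k (\<i> * complex_of_real y) \<noteq> 0 \<and> y > 0"
    by (intro eventually_conj q_factored_eventually_nonzero[OF g] q_factored_eventually_nonzero[OF g']
        eventually_gt_at_top)
  then obtain y :: real where y: "wronskian_det k (\<i> * complex_of_real y) \<noteq> 0"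
      "wronskian_det' k (\<i> * complex_of_real y) \<noteq> 0" "y > 0"
    using eventually_happens'[OF trivial_limit_at_top_linorder] by blast
  have H: "\<i> * complex_of_real y \<in> upper_half_plane"
    by (rule imaginary_axis_upper_half_plane[OF y(3)])
  have "alpha k \<noteq> 0" "beta k \<noteq> 0"
    unfolding alpha_def beta_def normalizing_constant[OF g] normalizing_constant[OF g']
    using g(2) g'(2) by auto
  then have "F k (\<i> * complex_of_real y) \<noteq> 0"
    using y H by (auto simp: F_def W_def W'_def)
  then show ?thesis using H by blast
qed

text \<open>Differentiating the relation kills the constant 1, and the rows start at the first
  derivative, so the vector \<open>c\<close> lies in the kernel. It is nonzero since the
  undifferentiated sum is 1.\<close>

lemma wronskian_det'_eq_0:
  assumes rel: "\<And>z. z \<in> upper_half_plane \<Longrightarrow> (\<Sum>j<k. c j * ch (j + 1) k z) = 1"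
    and z: "z \<in> upper_half_plane"
  shows "wronskian_det' k z = 0"
proof -
  have deriv: "(\<Sum>j<k. c j * (qderiv ^^ m) (ch (j + 1) k) z) = (if m = 0 then 1 else 0)"
    if "z \<in> upper_half_plane" for m z
    using that
  proof (induction m arbitrary: z)
    case 0
    then show ?case using rel by simp
  next
    case (Suc m)
    define f where "f j = (qderiv ^^ m) (ch (j + 1) k)" for j
    have D: "(f j has_field_derivative deriv (f j) z) (at z)" for j
      using has_field_derivative_q_factored[OF q_factored_qderiv_iter[OF q_factored_ch] Suc.prems]
      unfolding f_def by (metis DERIV_imp_deriv)
    have "((\<lambda>w. \<Sum>j<k. c j * f j w) has_field_derivative (\<Sum>j<k. c j * deriv (f j) z)) (at z)"
      by (intro DERIV_sum DERIV_cmult D)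
    moreover have "((\<lambda>w. \<Sum>j<k. c j * f j w) has_field_derivative 0) (at z)"
      by (rule has_field_derivative_transform_within_open[OF DERIV_const open_upper_half_plane Suc.prems])
         (simp only: f_def Suc.IH)
    ultimately have "(\<Sum>j<k. c j * deriv (f j) z) = 0" by (rule DERIV_unique)
    moreover have "(\<Sum>j<k. c j * (qderiv ^^ Suc m) (ch (j + 1) k) z) =
        (\<Sum>j<k. c j * deriv (f j) z) / (2 * of_real pi * \<i>)"
      unfolding sum_divide_distrib f_def funpow.simps o_apply by (simp only: qderiv_def times_divide_eq_right)
    ultimately show ?case by simp
  qed
  define A where "A = Matrix.mat k k (\<lambda>(m, j). (qderiv ^^ (m + 1)) (ch (j + 1) k) z)"
  define v where "v = Matrix.vec k c"
  have A: "A \<in> carrier_mat k k" by (simp add: A_def)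
  have "v \<noteq> 0\<^sub>v k"
  proof
    assume "v = 0\<^sub>v k"
    then have "c j = 0" if "j < k" for j using that by (metis index_vec index_zero_vec(1) v_def)
    then show False using rel[OF z] by simp
  qed
  moreover have "A *\<^sub>v v = 0\<^sub>v k"
  proof (intro eq_vecI)
    fix m assume "m < dim_vec (0\<^sub>v k)"
    then have "vec_index (A *\<^sub>v v) m = (\<Sum>j<k. c j * (qderiv ^^ (m + 1)) (ch (j + 1) k) z)"
      by (auto simp: A_def v_def scalar_prod_def atLeast0LessThan intro!: sum.cong)
    also have "\<dots> = 0" unfolding deriv[OF z] by simp
    finally show "vec_index (A *\<^sub>v v) m = vec_index (0\<^sub>v k) m" using \<open>m < dim_vec (0\<^sub>v k)\<close> by simp
  qed (simp add: A_def)
  moreover have "v \<in> carrier_vec k" by (simp add: v_def)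
  ultimately show ?thesis
    unfolding wronskian_det'_def A_def[symmetric] det_0_iff_vec_prod_zero_field[OF A] by blast
qed

text \<open>The dissection is divided by Euler's product. The powers of \<open>q\<close> agree
  because modulus \<open>3 s^2\<close> and index \<open>s (3 (r + u) + 1)\<close> give
  \<open>2k+1-2i = s (1 - 6 r)\<close>, hence the exponent
  \<open>((1 - 6 r)^2 - 1) / 24 = r (3 r - 1) / 2\<close>.\<close>

lemma ch_relation:
  fixes u k :: nat
  defines "s \<equiv> 2 * u + 1"
  assumes k: "2 * k + 1 = 3 * s\<^sup>2" and z: "z \<in> upper_half_plane"
  shows "(\<Sum>r\<in>{-int u..int u}. (-1) powi r * ch (s * (3 * nat (r + int u) + 1)) k z) = 1"
proof -
  define q where "q = qpow 1 z"
  define P where "P = euler_prod {1..} q"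
  have q: "q \<noteq> 0" "norm q < 1" using norm_qpow_1[OF z] by (auto simp: q_def)
  have P: "P \<noteq> 0" unfolding P_def by (rule euler_prod_nonzero[OF q(2)]) auto
  have summand: "(-1) powi r * ch (s * (3 * nat (r + int u) + 1)) k z =
      (-1) powi r * q powi (r + 3 * (r * (r - 1) div 2)) *
      euler_prod (excluded (3 * s\<^sup>2) (s * (3 * nat (r + int u) + 1))) q / P"
    if r: "r \<in> {-int u..int u}" for r
  proof -
    have "ch_exponent (s * (3 * nat (r + int u) + 1)) k = of_int (r + 3 * (r * (r - 1) div 2))"
    proof -
      obtain b where b: "r * (r - 1) = 2 * b"
        using dvd_def[of 2 "r * (r - 1)"] by auto
      define S R :: rat where "S = of_nat s" and "R = of_int r"
      have S: "S = 2 * of_nat u + 1" "S \<noteq> 0" by (simp_all add: S_def s_def)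
      have M: "2 * of_nat k + 1 = 3 * S\<^sup>2"
        using arg_cong[OF k, of rat_of_nat] by (simp add: S_def)
      have i: "rat_of_nat (s * (3 * nat (r + int u) + 1)) = S * (3 * (R + of_nat u) + 1)"
        using r by (simp add: S_def R_def of_nat_nat algebra_simps)
      have "3 * S\<^sup>2 - 2 * (S * (3 * (R + of_nat u) + 1)) = S * (1 - 6 * R)"
        unfolding S by (simp add: algebra_simps power2_eq_square)
      then have "ch_exponent (s * (3 * nat (r + int u) + 1)) k = (S * (1 - 6 * R))\<^sup>2 / (8 * (3 * S\<^sup>2)) - 1 / 24"
        unfolding ch_exponent_eq M i by simp
      also have "\<dots> = ((1 - 6 * R)\<^sup>2 - 1) / 24"
        using S(2) by (simp add: power_mult_distrib diff_divide_distrib)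
      also have "\<dots> = R + 3 * (R * (R - 1)) / 2"
        by (simp add: power2_eq_square field_simps)
      also have "R * (R - 1) = of_int (r * (r - 1))" by (simp add: R_def)
      finally show ?thesis unfolding b by (simp add: R_def)
    qed
    then show ?thesis
      unfolding ch_eq'[OF z] k by (simp add: q_def P_def qpow_of_int)
  qed
  have "(\<Sum>r\<in>{-int u..int u}. (-1) powi r * ch (s * (3 * nat (r + int u) + 1)) k z) =
      (\<Sum>r\<in>{-int u..int u}. (-1) powi r * q powi (r + 3 * (r * (r - 1) div 2)) *
        euler_prod (excluded (3 * s\<^sup>2) (s * (3 * nat (r + int u) + 1))) q / P)"
    by (intro sum.cong refl summand)
  also have "\<dots> = P / P"
    unfolding sum_divide_distrib[symmetric] pentagonal_dissection[OF q, of u, folded s_def P_def, symmetric] ..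
  finally have "(\<Sum>r\<in>{-int u..int u}. (-1) powi r * ch (s * (3 * nat (r + int u) + 1)) k z) = P / P" .
  then show ?thesis using P by simp
qed

lemma ch_linear_relation:
  fixes u k :: nat
  assumes k: "2 * k + 1 = 3 * (2 * u + 1)\<^sup>2"
  shows "\<exists>c. \<forall>z\<in>upper_half_plane. (\<Sum>j<k. c j * ch (j + 1) k z) = 1"
proof -
  define s where "s = 2 * u + 1"
  define i where "i r = s * (3 * nat (r + int u) + 1)" for r
  \<comment> \<open>Zero-based column of \<open>i r\<close>, or of its reflection
    \<open>2k+1 - i r\<close> when \<open>i r > k\<close>. The signs are then summed over the fibres
    of \<open>col\<close>.\<close>
  define col where "col r = (if i r \<le> k then i r - 1 else 2 * k - i r)" for r
  define I where "I = {- int u..int u}"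
  have bounds: "0 < i r" "i r < 2 * k + 1" if "r \<in> I" for r
  proof -
    have "nat (r + int u) \<le> 2 * u" using that by (auto simp: I_def)
    then have "i r \<le> s * (3 * (2 * u) + 1)" unfolding i_def by (intro mult_left_mono) auto
    also have "\<dots> < s * (3 * s)" by (intro mult_strict_left_mono) (auto simp: s_def)
    also have "\<dots> = 2 * k + 1" unfolding k s_def power2_eq_square by (simp only: ac_simps)
    finally show "i r < 2 * k + 1" .
    show "0 < i r" by (simp add: i_def s_def)
  qed
  have "(\<Sum>j<k. (\<Sum>r\<in>{r\<in>I. col r = j}. (-1) powi r) * ch (j + 1) k z) = 1"
    if z: "z \<in> upper_half_plane" for z
  proof -
    have "ch (col r + 1) k z = ch (i r) k z" if "r \<in> I" for r
    proof (cases "i r \<le> k")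
      case False
      then have "col r + 1 = 2 * k + 1 - i r" using bounds[OF that] by (simp add: col_def)
      then show ?thesis using ch_reflect[OF z, of "i r" k] bounds[OF that] by simp
    qed (use bounds[OF that] in \<open>simp add: col_def\<close>)
    then have "1 = (\<Sum>r\<in>I. (-1) powi r * ch (col r + 1) k z)"
      using ch_relation[OF k z] by (simp add: I_def i_def s_def)
    also have "\<dots> = (\<Sum>j<k. \<Sum>r\<in>{r\<in>I. col r = j}. (-1) powi r * ch (col r + 1) k z)"
    proof (rule sum.group[symmetric])
      show "col ` I \<subseteq> {..<k}"
        using bounds by (fastforce simp: col_def)
    qed (auto simp: I_def)
    also have "\<dots> = (\<Sum>j<k. (\<Sum>r\<in>{r\<in>I. col r = j}. (-1) powi r) * ch (j + 1) k z)"
      unfolding sum_distrib_right by (intro sum.cong) auto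
    finally show ?thesis ..
  qed
  then show ?thesis by (intro exI[of _ "\<lambda>j. \<Sum>r\<in>{r\<in>I. col r = j}. (-1) powi r"] ballI)
qed

theorem theorem1p3:
  fixes k :: nat
  assumes "k \<ge> 2"
  shows "(\<forall>z\<in>upper_half_plane. F k z = 0) \<longleftrightarrow>
         (\<exists>t::int. t \<ge> 2 \<and> int k = 6 * t^2 - 6 * t + 1)"
proof
  assume "\<forall>z\<in>upper_half_plane. F k z = 0"
  then obtain i where i: "i \<in> {1..k}" "ch_exponent i k = 0"
    using F_not_identically_0 by blast
  \<comment> \<open>Chosen so that \<open>2 t - 1 = 2k+1-2i\<close>, the odd number whose square is
    a third of \<open>2k+1\<close>.\<close>
  define t where "t = int k - int i + 1"
  have "3 * (2 * t - 1)\<^sup>2 = 2 * int k + 1"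
    using ch_exponent_eq_0[OF i(2)] by (simp add: t_def algebra_simps)
  then have k: "int k = 6 * t\<^sup>2 - 6 * t + 1"
    by (simp add: power2_eq_square algebra_simps)
  have "t \<ge> 1" using i by (simp add: t_def)
  \<comment> \<open>The value \<open>t = 1\<close> would give \<open>k = 1\<close>.\<close>
  moreover have "t \<noteq> 1" using k assms by auto
  ultimately show "\<exists>t::int. t \<ge> 2 \<and> int k = 6 * t^2 - 6 * t + 1"
    using k by (intro exI[of _ t]) auto
next
  assume "\<exists>t::int. t \<ge> 2 \<and> int k = 6 * t^2 - 6 * t + 1"
  then obtain t :: int where t: "t \<ge> 2" "int k = 6 * t\<^sup>2 - 6 * t + 1" by blast
  \<comment> \<open>With this \<open>u\<close>, the dissection modulus \<open>2 u + 1\<close> is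
    \<open>2 t - 1\<close>.\<close>
  define u where "u = nat (t - 1)"
  have "int (2 * k + 1) = int (3 * (2 * u + 1)\<^sup>2)"
    using t by (simp add: u_def power2_eq_square algebra_simps)
  then have "2 * k + 1 = 3 * (2 * u + 1)\<^sup>2" by (simp only: of_nat_eq_iff)
  then obtain c where "\<forall>z\<in>upper_half_plane. (\<Sum>j<k. c j * ch (j + 1) k z) = 1"
    using ch_linear_relation by blast
  then have "\<forall>z\<in>upper_half_plane. wronskian_det' k z = 0"
    using wronskian_det'_eq_0 by blast
  then show "\<forall>z\<in>upper_half_plane. F k z = 0"
    by (simp add: F_def W'_def)
qed

end
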